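(* For every word $w=w_1\cdots w_n$ of positive integers, $\mathcal D(w)=\mathcal D(Q(w))$, where $\mathcal D(w)=\{i: w_i>w_{i+1}\}$ and $Q(w)$ is the shifted Hecke recording tableau of $w$.
   Context: Shifted shapes: for a strict partition $\lambda$, boxes $(i,j)$ with $i\le j\le i+\lambda_i-1$; boxes $(i,i)$ form the main diagonal. Increasing shifted tableau: entries strictly increase along rows and down columns. Shifted Hecke insertion of $x$ into an increasing shifted tableau $T$, with its termination box: first insert $x$ into row 1. When $x$ is inserted into a row (resp. column): (i) if $x$ is weakly larger than all entries and adjoining a box containing $x$ at the end of that row (resp. column) gives an increasing shifted tableau, do so and stop; the insertion terminates at the new box (adjoining to an empty row $i$ means adding box $(i,i)$). (ii) If $x$ is weakly larger than all entries but adjoining fails to give an increasing shifted tableau, leave the tableau unchanged and stop; if $x$ was row-inserted into a nonempty row, the insertion terminates at the bottom box of the column containing the rightmost box of that row; if $x$ was row-inserted into an empty row, it terminates at the rightmost box of the previous row; if $x$ was column-inserted, it terminates at the rightmost box of the row containing the bottom box of that column. (iii) Otherwise let $y$ be the smallest entry strictly larger than $x$ there; replace $y$ by $x$ if the result is increasing, otherwise change nothing; in either case $y$ is output: if $x$ was inserted into a column or $y$ lies on the main diagonal, $y$ is inserted into the next column to the right (all subsequent outputs go into successive columns), otherwise into the next row below. Recording tableau $Q(w)$: start from the empty tableau; when inserting $w_k$ into $P(w_1\cdots w_{k-1})$: if a new box is added, add that box to $Q$ with label $k$, or $k'$ if the box was added by column insertion; if the shape does not change, add the label $k$ to the termination box,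 or $k'$ if the insertion ended during column insertion or by failing to insert into an empty row. $Q(w)$ is a standard set-valued shifted tableau: each box contains a nonempty set of labels, and each of $1,\dots,n$ appears exactly once, either primed or unprimed. Descent set of a standard set-valued shifted tableau $Q$ with labels $1,\dots,n$: $\mathcal D(Q)$ is the set of $i\in[n-1]$ such that (a) $i$ appears unprimed and $i+1$ appears primed; or (b) $i$ and $i+1$ both appear unprimed and the box containing $i$ is in a row strictly above the box containing $i+1$; or (c) $i'$ and $(i+1)'$ both appear and the box containing $i'$ is in a row weakly below the box containing $(i+1)'$ and is a different box. *)

theory Defs
  imports Main
begin

text \<open>Boxes are pairs (row, column), 1-indexed; box (i,j) with i \<le> j.
  A tableau is a partial map from boxes to positive integers; its shape is its domain.\<close>

type_synonym tab = "nat \<times> nat \<Rightarrow> nat option"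

text \<open>Recording tableau: each box carries a set of labels (k, primed).\<close>
type_synonym qtab = "nat \<times> nat \<Rightarrow> (nat \<times> bool) set"

definition shifted_shape :: "(nat \<times> nat) set \<Rightarrow> bool" where
  "shifted_shape S \<longleftrightarrow> (\<exists>lam :: nat list. sorted_wrt (>) lam \<and> (\<forall>l\<in>set lam. 0 < l) \<and>
     S = {(i, j). 1 \<le> i \<and> i \<le> length lam \<and> i \<le> j \<and> j < i + lam ! (i - 1)})"

definition increasing :: "tab \<Rightarrow> bool" where
  "increasing T \<longleftrightarrow>
     (\<forall>i j j' a b. j < j' \<longrightarrow> T (i, j) = Some a \<longrightarrow> T (i, j') = Some b \<longrightarrow> a < b) \<and>
     (\<forall>i i' j a b. i < i' \<longrightarrow> T (i, j) = Some a \<longrightarrow> T (i', j) = Some b \<longrightarrow> a < b)"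

definition inc_shifted :: "tab \<Rightarrow> bool" where
  "inc_shifted T \<longleftrightarrow> shifted_shape (dom T) \<and> increasing T"

definition row_entries :: "tab \<Rightarrow> nat \<Rightarrow> nat set" where
  "row_entries T i = {v. \<exists>j. T (i, j) = Some v}"

definition col_entries :: "tab \<Rightarrow> nat \<Rightarrow> nat set" where
  "col_entries T j = {v. \<exists>i. T (i, j) = Some v}"

definition row_end :: "tab \<Rightarrow> nat \<Rightarrow> nat \<times> nat" where
  "row_end T i = (if \<exists>j. (i, j) \<in> dom T then (i, Max {j. (i, j) \<in> dom T} + 1) else (i, i))"

definition col_end :: "tab \<Rightarrow> nat \<Rightarrow> nat \<times> nat" where
  "col_end T j = (if \<exists>i. (i, j) \<in> dom T then (Max {i. (i, j) \<in> dom T} + 1, j) else (1, j))"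

definition rightmost :: "tab \<Rightarrow> nat \<Rightarrow> nat \<times> nat" where
  "rightmost T i = (i, Max {j. (i, j) \<in> dom T})"

definition bottom :: "tab \<Rightarrow> nat \<Rightarrow> nat \<times> nat" where
  "bottom T j = (Max {i. (i, j) \<in> dom T}, j)"

datatype imode = RowI nat | ColI nat

text \<open>One run of shifted Hecke insertion, with an explicit fuel argument (the number of
  remaining row/column insertion steps).  Result: new tableau, termination box, and
  whether the recording label is primed (True) or unprimed (False).\<close>
primrec hins :: "nat \<Rightarrow> tab \<Rightarrow> nat \<Rightarrow> imode \<Rightarrow> tab \<times> (nat \<times> nat) \<times> bool" where
  "hins 0 T x m = (T, (0, 0), False)"
| "hins (Suc f) T x m = (case m of RowI i \<Rightarrow>
     (if \<forall>v\<in>row_entries T i. v \<le> x then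
        (let b = row_end T i in
         if inc_shifted (T(b \<mapsto> x)) then (T(b \<mapsto> x), b, False)
         else if row_entries T i \<noteq> {} then (T, bottom T (snd (rightmost T i)), False)
         else (T, rightmost T (i - 1), True))
      else
        (let y = Min {v \<in> row_entries T i. x < v};
             j = (SOME j. T (i, j) = Some y);
             T' = (if inc_shifted (T((i, j) \<mapsto> x)) then T((i, j) \<mapsto> x) else T)
         in if i = j then hins f T' y (ColI (j + 1)) else hins f T' y (RowI (i + 1))))
   | ColI j \<Rightarrow>
     (if \<forall>v\<in>col_entries T j. v \<le> x then
        (let b = col_end T j in
         if inc_shifted (T(b \<mapsto> x)) then (T(b \<mapsto> x), b, True)
         else (T, rightmost T (fst (bottom T j)), True))
      else
        (let y = Min {v \<in> col_entries T j. x < v};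
             i = (SOME i. T (i, j) = Some y);
             T' = (if inc_shifted (T((i, j) \<mapsto> x)) then T((i, j) \<mapsto> x) else T)
         in hins f T' y (ColI (j + 1)))))"

text \<open>Shifted Hecke insertion of x into T, starting with row 1.  The fuel
  2 * |T| + 3 exceeds the number of rows plus columns of T plus 2, so it never runs out.\<close>
definition hecke_insert :: "tab \<Rightarrow> nat \<Rightarrow> tab \<times> (nat \<times> nat) \<times> bool" where
  "hecke_insert T x = hins (2 * card (dom T) + 3) T x (RowI 1)"

definition hecke_step :: "tab \<times> qtab \<Rightarrow> nat \<times> nat \<Rightarrow> tab \<times> qtab" where
  "hecke_step PQ kx = (case PQ of (P, Q) \<Rightarrow> case kx of (k, x) \<Rightarrow>
     (case hecke_insert P x of (P', b, pr) \<Rightarrow> (P', Q(b := Q b \<union> {(k, pr)}))))"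

definition hecke_PQ :: "nat list \<Rightarrow> tab \<times> qtab" where
  "hecke_PQ w = foldl hecke_step (Map.empty, (\<lambda>_. {})) (zip [1..<length w + 1] w)"

definition hecke_Q :: "nat list \<Rightarrow> qtab" where
  "hecke_Q w = snd (hecke_PQ w)"

definition word_des :: "nat list \<Rightarrow> nat set" where
  "word_des w = {i. 1 \<le> i \<and> i < length w \<and> w ! (i - 1) > w ! i}"

text \<open>Descent set of a standard set-valued shifted tableau with labels 1..n.
  (k, False) is the unprimed label k, (k, True) the primed label k'.\<close>
definition tab_des :: "qtab \<Rightarrow> nat \<Rightarrow> nat set" where
  "tab_des Q n = {i. 1 \<le> i \<and> i < n \<and>
     ((\<exists>b b'. (i, False) \<in> Q b \<and> (i + 1, True) \<in> Q b') \<or>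
      (\<exists>b b'. (i, False) \<in> Q b \<and> (i + 1, False) \<in> Q b' \<and> fst b < fst b') \<or>
      (\<exists>b b'. (i, True) \<in> Q b \<and> (i + 1, True) \<in> Q b' \<and> fst b' \<le> fst b \<and> b \<noteq> b'))}"

end

theory Submission
  imports Defs
begin

text \<open>Compare the bumping paths of two successive insertions, of \<open>x\<close> and then of \<open>y\<close>, line by line. If
  \<open>y < x\<close>, then at each line that the first path visits the second one inserts a smaller value and has
  turned to column insertion if the first has; so if both end in row insertion, the second one ends further
  down. If \<open>x \<le> y\<close>, the roles are exchanged and the comparison of values is weak. In column mode the bumped
  boxes move weakly up, and a primed termination box is always the rightmost box of its row; hence for two
  primed labels only the rows matter, together with whether the second insertion adds a box.\<close>

subsection \<open>Shifted shapes and increasing tableaux\<close>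

text \<open>The main obstacle is that a step may change nothing, so the second insertion need not
  find the first inserted value in the box that was hit. The remedy is \<open>trace\<close>: such a
  value is blocked by an equal one to the left or above, and this copy survives to the end of the
  run. A copy on the same line is met by the second insertion directly. If it lies on the preceding
  line, the box that the second path hits there has a neighbour on the current line that serves
  instead. A second obstacle is that the paths may be in different modes on lines with the same
  number, one in row k and the other in column k. They are then compared through the diagonal box
  (k, k), which lies on both. Finally, when no box is added, an unprimed label goes to the bottom of
  a column, possibly far below the row where the path ended. Comparing rows of termination boxes
  therefore needs the shape and not only the lengths of the paths.\<close>

text \<open>The list of parts is traded for an order ideal of the staircase. Existence of
  neighbouring boxes and the legality of adding a box then reduce to closure under moving up or
  left.\<close>

lemma shifted_shape_iff:
  "shifted_shape S \<longleftrightarrow> finite S \<and> (\<forall>i j. (i, j) \<in> S \<longrightarrow> 1 \<le> i \<and> i \<le> j) \<and>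
     (\<forall>i j i' j'. (i, j) \<in> S \<longrightarrow> 1 \<le> i' \<longrightarrow> i' \<le> i \<longrightarrow> i' \<le> j' \<longrightarrow> j' \<le> j \<longrightarrow> (i', j') \<in> S)"
  (is "_ \<longleftrightarrow> ?fin \<and> ?pos \<and> ?down")
proof
  assume "shifted_shape S"
  then obtain lam where lam: "sorted_wrt (>) lam" "\<forall>l\<in>set lam. 0 < l"
    and S: "S = {(i, j). 1 \<le> i \<and> i \<le> length lam \<and> i \<le> j \<and> j < i + lam ! (i - 1)}"
    unfolding shifted_shape_def by blast
  have "S \<subseteq> (SIGMA i:{1..length lam}. {i..<i + lam ! (i - 1)})" using S by auto
  then have fin: ?fin by (rule finite_subset) auto
  \<comment> \<open>For the 0-based row index \<open>a\<close>, the number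
    \<open>a + lam ! a\<close> is the last column of that row.\<close>
  have drop: "b + lam ! b \<le> a + lam ! a" if "a \<le> b" "b < length lam" for a b
    using that
  proof (induct "b - a" arbitrary: a)
    case (Suc n)
    have "Suc a + lam ! Suc a \<le> a + lam ! a"
      using sorted_wrt_nth_less[OF lam(1), of a "Suc a"] Suc.hyps(2) Suc.prems by linarith
    moreover have "b + lam ! b \<le> Suc a + lam ! Suc a"
      by (rule Suc.hyps(1)) (use Suc.hyps(2) Suc.prems in linarith)+
    ultimately show ?case by linarith
  qed auto
  have down: "(i', j') \<in> S" if "(i, j) \<in> S" "1 \<le> i'" "i' \<le> i" "i' \<le> j'" "j' \<le> j" for i j i' j'
  proof -
    have ij: "i \<le> length lam" "j < i + lam ! (i - 1)" using that(1) by (auto simp: S)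
    have "i - 1 + lam ! (i - 1) \<le> i' - 1 + lam ! (i' - 1)"
      using that ij by (intro drop) auto
    then have "j' < i' + lam ! (i' - 1)" using that ij by linarith
    then show ?thesis using that ij by (simp add: S)
  qed
  have "1 \<le> i \<and> i \<le> j" if "(i, j) \<in> S" for i j using that by (simp add: S)
  then show "?fin \<and> ?pos \<and> ?down" using fin down by blast
next
  assume R: "?fin \<and> ?pos \<and> ?down"
  have pos: "1 \<le> i" "i \<le> j" if "(i, j) \<in> S" for i j using R that by blast+
  have down: "(i', j') \<in> S" if "(i, j) \<in> S" "1 \<le> i'" "i' \<le> i" "i' \<le> j'" "j' \<le> j" for i j i' j'
    using R that by blast
  have fS: "finite S" using R by blast
  define r where "r i = card {j. (i, j) \<in> S}" for i
  have finr: "finite {j. (i, j) \<in> S}" for i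
    by (rule finite_subset[OF _ finite_imageI[OF fS, of snd]]) (force simp: image_iff)
  have row: "{j. (i, j) \<in> S} = {i..<i + r i}" if "1 \<le> i" for i
  proof (cases "{j. (i, j) \<in> S} = {}")
    case True
    then show ?thesis unfolding r_def by simp
  next
    case False
    define m where "m = Max {j. (i, j) \<in> S}"
    have m: "(i, m) \<in> S" using Max_in[OF finr False] by (simp add: m_def)
    have m': "j \<le> m" if "(i, j) \<in> S" for j using that finr by (simp add: m_def)
    have "(i, j) \<in> S \<longleftrightarrow> j \<in> {i..m}" for j
      using m m'[of j] pos[of i j] down[of i m i j] that by (meson atLeastAtMost_iff order_refl)
    then have "{j. (i, j) \<in> S} = {i..m}" by blast
    moreover have "i \<le> m" using pos m by blast
    ultimately show ?thesis unfolding r_def by auto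
  qed
  define n where "n = card {i. (i, i) \<in> S}"
  have finc: "finite {i. (i, i) \<in> S}"
    by (rule finite_subset[OF _ finite_imageI[OF fS, of fst]]) (force simp: image_iff)
  have diag: "(i, i) \<in> S \<longleftrightarrow> 1 \<le> i \<and> i \<le> n" for i
  proof (cases "{i. (i, i) \<in> S} = {}")
    case True
    then show ?thesis unfolding n_def by simp
  next
    case False
    define m where "m = Max {i. (i, i) \<in> S}"
    have m: "(m, m) \<in> S" using Max_in[OF finc False] by (simp add: m_def)
    have m': "j \<le> m" if "(j, j) \<in> S" for j using that finc by (simp add: m_def)
    have eq: "(j, j) \<in> S \<longleftrightarrow> j \<in> {1..m}" for j
      using m m'[of j] pos[of j j] down[of m m j j] by (meson atLeastAtMost_iff order_refl)
    then have "{i. (i, i) \<in> S} = {1..m}" by blast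
    then have "n = m" by (simp add: n_def)
    then show ?thesis using eq[of i] by simp
  qed
  have row_iff: "(i, j) \<in> S \<longleftrightarrow> i \<le> j \<and> j < i + r i" if "1 \<le> i" for i j
  proof -
    have "(i, j) \<in> S \<longleftrightarrow> j \<in> {i..<i + r i}" using row[OF that] by blast
    then show ?thesis by simp
  qed
  \<comment> \<open>Row \<open>a\<close> reaches at least as far right as row \<open>b\<close> but
    starts further left.\<close>
  have dec: "r b < r a" if "1 \<le> a" "a < b" "0 < r b" for a b
  proof -
    have "(b, b + r b - 1) \<in> S" using row_iff[of b "b + r b - 1"] that by simp
    then have "(a, b + r b - 1) \<in> S"
      by (rule down) (use that in linarith)+
    then show ?thesis using row_iff[of a "b + r b - 1"] that by linarith
  qed
  have rpos: "0 < r i" if "1 \<le> i" "i \<le> n" for i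
    using that diag[of i] row_iff[of i i] by simp
  define lam where "lam = map r [1..<Suc n]"
  have "sorted_wrt (>) lam" unfolding sorted_wrt_iff_nth_less lam_def
    using dec rpos by (simp del: upt_Suc)
  moreover have "\<forall>l\<in>set lam. 0 < l" using rpos by (simp add: lam_def del: upt_Suc)
  moreover have "S = {(i, j). 1 \<le> i \<and> i \<le> length lam \<and> i \<le> j \<and> j < i + lam ! (i - 1)}"
  proof -
    have iff: "(i, j) \<in> S \<longleftrightarrow> 1 \<le> i \<and> i \<le> n \<and> i \<le> j \<and> j < i + r i" for i j
    proof (cases "1 \<le> i")
      case True
      then show ?thesis using row_iff[of i j] row_iff[of i i] diag[of i] by auto
    qed (use pos in blast)
    have "(i, j) \<in> S \<longleftrightarrow> 1 \<le> i \<and> i \<le> length lam \<and> i \<le> j \<and> j < i + lam ! (i - 1)" for i j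
      unfolding iff by (auto simp: lam_def simp del: upt_Suc)
    then show ?thesis by auto
  qed
  ultimately show "shifted_shape S" unfolding shifted_shape_def by blast
qed

lemma inc_shifted_finite: "inc_shifted T \<Longrightarrow> finite (dom T)"
  unfolding inc_shifted_def shifted_shape_iff by blast

lemma inc_shifted_pos: "inc_shifted T \<Longrightarrow> (i, j) \<in> dom T \<Longrightarrow> 1 \<le> i \<and> i \<le> j"
  unfolding inc_shifted_def shifted_shape_iff by blast

lemma inc_shifted_down:
  "inc_shifted T \<Longrightarrow> (i, j) \<in> dom T \<Longrightarrow> 1 \<le> i' \<Longrightarrow> i' \<le> i \<Longrightarrow> i' \<le> j' \<Longrightarrow> j' \<le> j \<Longrightarrow> (i', j') \<in> dom T"
  unfolding inc_shifted_def shifted_shape_iff by blast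

lemma inc_shifted_pos_Some: "inc_shifted T \<Longrightarrow> T (i, j) = Some v \<Longrightarrow> 1 \<le> i \<and> i \<le> j"
  using inc_shifted_pos[of T i j] by blast

lemma inc_shifted_down_Some:
  "inc_shifted T \<Longrightarrow> T (i, j) = Some v \<Longrightarrow> 1 \<le> i' \<Longrightarrow> i' \<le> i \<Longrightarrow> i' \<le> j' \<Longrightarrow> j' \<le> j \<Longrightarrow> (i', j') \<in> dom T"
  using inc_shifted_down[of T i j] by blast

text \<open>The comparison passes through the corner (i, j'), which exists because i \<le> i' \<le>
  j'; the opposite corner (i', j) may lie below the diagonal.\<close>

lemma inc_shifted_mono:
  assumes "inc_shifted T" "T (i, j) = Some u" "T (i', j') = Some v" "i \<le> i'" "j \<le> j'"
  shows "u \<le> v" "(i, j) \<noteq> (i', j') \<Longrightarrow> u < v"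
proof -
  have "(i, j') \<in> dom T"
    using inc_shifted_down[OF assms(1), of i' j' i j'] inc_shifted_pos[OF assms(1)] assms(2-) by force
  then obtain w where w: "T (i, j') = Some w" by blast
  have "u \<le> w" "j \<noteq> j' \<Longrightarrow> u < w" "w \<le> v" "i \<noteq> i' \<Longrightarrow> w < v"
    using assms w unfolding inc_shifted_def increasing_def
    by (metis le_eq_less_or_eq option.inject order_refl)+
  then show "u \<le> v" "(i, j) \<noteq> (i', j') \<Longrightarrow> u < v" by auto
qed

text \<open>If the shape permits the box and all entries to its right and below exceed
  \<open>x\<close>, only the left or the upper neighbour can prevent writing \<open>x\<close>. This
  covers replacing an entry and adding a box alike.\<close>

lemma not_inc_shifted_upd:
  assumes T: "inc_shifted T" and q: "1 \<le> i" "i \<le> j"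
    and left: "j = i \<or> (i, j - 1) \<in> dom T" and above: "i = 1 \<or> (i - 1, j) \<in> dom T"
    and right: "\<And>j' v. j < j' \<Longrightarrow> T (i, j') = Some v \<Longrightarrow> x < v"
    and below: "\<And>i' v. i < i' \<Longrightarrow> T (i', j) = Some v \<Longrightarrow> x < v"
    and bad: "\<not> inc_shifted (T((i, j) \<mapsto> x))"
  shows "(\<exists>v\<ge>x. T (i, j - 1) = Some v) \<or> (\<exists>v\<ge>x. T (i - 1, j) = Some v)"
proof (rule ccontr)
  assume good: "\<not> ?thesis"
  note pos = inc_shifted_pos[OF T] and down = inc_shifted_down[OF T]
  have "shifted_shape (dom (T((i, j) \<mapsto> x)))"
    unfolding shifted_shape_iff
  proof (intro conjI allI impI)
    show "finite (dom (T((i, j) \<mapsto> x)))" using inc_shifted_finite[OF T] by simp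
  next
    fix a b a' b' assume ab: "(a, b) \<in> dom (T((i, j) \<mapsto> x))" "1 \<le> a'" "a' \<le> a" "a' \<le> b'" "b' \<le> b"
    have "(a', b') \<in> dom T" if "(a', b') \<noteq> (i, j)" "(a, b) = (i, j)"
    proof (cases "a' = i")
      case True
      then have "(i, j - 1) \<in> dom T" "b' \<le> j - 1" using that ab left by auto
      then show ?thesis using True ab down[of i "j - 1" a' b'] by simp
    next
      case False
      then have "(i - 1, j) \<in> dom T" "a' \<le> i - 1" using that ab above by auto
      then show ?thesis using that ab down[of "i - 1" j a' b'] by simp
    qed
    then show "(a', b') \<in> dom (T((i, j) \<mapsto> x))"
      using ab down[of a b a' b'] by (auto split: if_splits)
  qed (use pos q in \<open>auto split: if_splits\<close>)
  moreover have l: "v < x" if "j' < j" "T (i, j') = Some v" for j' v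
  proof -
    have "(i, j - 1) \<in> dom T" using left that pos[OF domI, of i j' v] by auto
    then obtain w where "T (i, j - 1) = Some w" by blast
    then show ?thesis using good inc_shifted_mono(1)[OF T that(2), of i "j - 1" w] that by force
  qed
  moreover have a: "v < x" if "i' < i" "T (i', j) = Some v" for i' v
  proof -
    have "(i - 1, j) \<in> dom T" using above that pos[OF domI, of i' j v] by auto
    then obtain w where "T (i - 1, j) = Some w" by blast
    then show ?thesis using good inc_shifted_mono(1)[OF T that(2), of "i - 1" j w] that by force
  qed
  have row: "u < v" if "c < c'" "T (r, c) = Some u" "T (r, c') = Some v" for r c c' u v
    using T that unfolding inc_shifted_def increasing_def by blast
  have col: "u < v" if "r < r'" "T (r, c) = Some u" "T (r', c) = Some v" for r r' c u v
    using T that unfolding inc_shifted_def increasing_def by blast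
  have "increasing (T((i, j) \<mapsto> x))"
    unfolding increasing_def
  proof (intro conjI allI impI)
    fix r c c' u v assume A: "c < c'" "(T((i, j) \<mapsto> x)) (r, c) = Some u" "(T((i, j) \<mapsto> x)) (r, c') = Some v"
    show "u < v"
      using A row[of c c' r u v] l[of c u] right[of c' v]
      by (cases "(r, c) = (i, j)"; cases "(r, c') = (i, j)") auto
  next
    fix r r' c u v assume A: "r < r'" "(T((i, j) \<mapsto> x)) (r, c) = Some u" "(T((i, j) \<mapsto> x)) (r', c) = Some v"
    show "u < v"
      using A col[of r r' c u v] a[of r u] below[of r' v]
      by (cases "(r, c) = (i, j)"; cases "(r', c) = (i, j)") auto
  qed
  ultimately show False using bad unfolding inc_shifted_def by blast
qed

text \<open>Replaces the \<open>Max\<close> of the definition by an interval; an empty row is the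
  case j = k.\<close>

lemma row_end_iff:
  assumes "inc_shifted T" "1 \<le> k"
  obtains j where "row_end T k = (k, j)" "k \<le> j" "\<And>j'. (k, j') \<in> dom T \<longleftrightarrow> k \<le> j' \<and> j' < j"
proof (cases "\<exists>j. (k, j) \<in> dom T")
  case True
  define m where "m = Max {j. (k, j) \<in> dom T}"
  have fin: "finite {j. (k, j) \<in> dom T}"
    by (rule finite_subset[OF _ finite_imageI[OF inc_shifted_finite[OF assms(1)], of snd]]) (force simp: image_iff)
  have m: "(k, m) \<in> dom T" using Max_in[OF fin] True unfolding m_def by auto
  have m': "j \<le> m" if "(k, j) \<in> dom T" for j using Max_ge[OF fin] that unfolding m_def by simp
  show ?thesis
  proof (rule that)
    show "row_end T k = (k, m + 1)" using True by (simp add: row_end_def m_def)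
    show "k \<le> m + 1" using inc_shifted_pos[OF assms(1) m] by simp
    show "(k, j') \<in> dom T \<longleftrightarrow> k \<le> j' \<and> j' < m + 1" for j'
      using m m'[of j'] inc_shifted_pos[OF assms(1), of k j'] inc_shifted_down[OF assms(1) m, of k j'] assms(2)
      by linarith
  qed
next
  case False
  then show ?thesis using that[of k] unfolding row_end_def by auto
qed

lemma col_end_iff:
  assumes "inc_shifted T"
  obtains i where "col_end T k = (i, k)" "1 \<le> i" "\<And>i'. (i', k) \<in> dom T \<longleftrightarrow> 1 \<le> i' \<and> i' < i"
proof (cases "\<exists>i. (i, k) \<in> dom T")
  case True
  define m where "m = Max {i. (i, k) \<in> dom T}"
  have fin: "finite {i. (i, k) \<in> dom T}"
    by (rule finite_subset[OF _ finite_imageI[OF inc_shifted_finite[OF assms(1)], of fst]]) (force simp: image_iff)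
  have m: "(m, k) \<in> dom T" using Max_in[OF fin] True unfolding m_def by auto
  have m': "i \<le> m" if "(i, k) \<in> dom T" for i using Max_ge[OF fin] that unfolding m_def by simp
  show ?thesis
  proof (rule that)
    show "col_end T k = (m + 1, k)" using True by (simp add: col_end_def m_def)
    show "(i', k) \<in> dom T \<longleftrightarrow> 1 \<le> i' \<and> i' < m + 1" for i'
      using m m'[of i'] inc_shifted_pos[OF assms(1), of i' k] inc_shifted_pos[OF assms(1) m]
        inc_shifted_down[OF assms(1) m, of i' k] by linarith
  qed simp
next
  case False
  then show ?thesis using that[of 1] unfolding col_end_def by auto
qed

lemma rightmost_eq:
  assumes "inc_shifted T" "(k, e) \<in> dom T" "(k, Suc e) \<notin> dom T"
  shows "rightmost T k = (k, e)"
proof -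
  note k = inc_shifted_pos[OF assms(1,2)]
  have "j \<le> e" if "(k, j) \<in> dom T" for j
    using inc_shifted_down[OF assms(1) that, of k "Suc e"] assms(3) k by (cases "j \<le> e") auto
  then have "(k, j) \<in> dom T \<longleftrightarrow> j \<in> {k..e}" for j
    using inc_shifted_pos[OF assms(1), of k j] inc_shifted_down[OF assms(1,2), of k j] k
    by (meson atLeastAtMost_iff order_refl)
  then have "{j. (k, j) \<in> dom T} = {k..e}" by blast
  moreover have "Max {k..e} = e" using k by (intro Max_eqI) auto
  ultimately show ?thesis by (simp add: rightmost_def)
qed

lemma fst_rightmost [simp]: "fst (rightmost S i) = i"
  by (simp add: rightmost_def)

lemma rightmost_in:
  assumes "inc_shifted T" "(k, j) \<in> dom T"
  shows "rightmost T k \<in> dom T"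
proof -
  have k: "1 \<le> k" "k \<le> j" using inc_shifted_pos[OF assms] by auto
  obtain e where e: "\<And>j'. (k, j') \<in> dom T \<longleftrightarrow> k \<le> j' \<and> j' < e"
    using row_end_iff[OF assms(1) k(1)] by metis
  have "j < e" using e assms(2) by blast
  then have "(k, e - 1) \<in> dom T" "(k, Suc (e - 1)) \<notin> dom T" unfolding e using k by linarith+
  then show ?thesis using rightmost_eq[OF assms(1)] by metis
qed

lemma rightmost_dom: "dom S = dom S' \<Longrightarrow> rightmost S = rightmost S'"
  by (simp add: rightmost_def fun_eq_iff)

lemma same_row_end:
  assumes "inc_shifted S" "(k, e) \<in> dom S" "(k, Suc e) \<notin> dom S" "(k, e') \<in> dom S" "(k, Suc e') \<notin> dom S"
  shows "e = e'"
  using rightmost_eq[OF assms(1-3)] rightmost_eq[OF assms(1,4,5)] by simp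

lemma bottom_eq:
  assumes "inc_shifted T" "(e, k) \<in> dom T" "(Suc e, k) \<notin> dom T"
  shows "bottom T k = (e, k)"
proof -
  note k = inc_shifted_pos[OF assms(1,2)]
  have "i \<le> e" if "(i, k) \<in> dom T" for i
    using inc_shifted_down[OF assms(1) that, of "Suc e" k] assms(3) inc_shifted_pos[OF assms(1) that]
    by (cases "i \<le> e") (auto simp del: domIff)
  then have "(i, k) \<in> dom T \<longleftrightarrow> i \<in> {1..e}" for i
    using inc_shifted_pos[OF assms(1), of i k] inc_shifted_down[OF assms(1,2), of i k] k
    by (meson atLeastAtMost_iff order_refl order_trans)
  then have "{i. (i, k) \<in> dom T} = {1..e}" by blast
  moreover have "Max {1..e} = e" using k by (intro Max_eqI) auto
  ultimately show ?thesis by (simp add: bottom_def)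
qed

subsection \<open>Insertion as a run of bumping steps\<close>

text \<open>The flag is \<open>True\<close> for columns and \<open>False\<close> for rows, so that
  both modes share one formulation.\<close>

definition on_line :: "bool \<Rightarrow> nat \<Rightarrow> nat \<times> nat \<Rightarrow> bool" where
  "on_line c k q \<longleftrightarrow> (if c then snd q else fst q) = k"

definition line_end :: "tab \<Rightarrow> bool \<Rightarrow> nat \<Rightarrow> nat \<times> nat" where
  "line_end T c k = (if c then col_end T k else row_end T k)"

definition place :: "tab \<Rightarrow> nat \<times> nat \<Rightarrow> nat \<Rightarrow> tab" where
  "place T q x = (if inc_shifted (T(q \<mapsto> x)) then T(q \<mapsto> x) else T)"

text \<open>The termination box and prime of a terminating call of \<open>hins\<close>; its tableau
  component is given by \<open>place\<close>.\<close>

definition outcome :: "tab \<Rightarrow> bool \<Rightarrow> nat \<Rightarrow> nat \<Rightarrow> (nat \<times> nat) \<times> bool" where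
  "outcome T c k x =
     (if inc_shifted (T(line_end T c k \<mapsto> x)) then (line_end T c k, c)
      else if c then (rightmost T (fst (bottom T k)), True)
      else if row_entries T k \<noteq> {} then (bottom T (snd (rightmost T k)), False)
      else (rightmost T (k - 1), True))"

text \<open>An insertion visits row 1, row 2, and so on up to the row where it bumps a diagonal box \<open>(k, k)\<close>,
  and then column \<open>k + 1\<close>, column \<open>k + 2\<close>, and so on; so in either mode the \<open>k\<close>-th step acts on the
  line with number \<open>k\<close>. In step \<open>k\<close> the value \<open>X k\<close> enters the tableau \<open>TT k\<close>, by column insertion iff
  \<open>C k\<close>, and hits the box \<open>p k\<close>; for the last step \<open>N\<close> this is the box behind the end of the line.\<close>
definition bump_run :: "nat \<Rightarrow> nat \<Rightarrow> (nat \<Rightarrow> tab) \<Rightarrow> (nat \<Rightarrow> nat) \<Rightarrow> (nat \<Rightarrow> bool) \<Rightarrow> (nat \<Rightarrow> nat \<times> nat) \<Rightarrow> bool" where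
  "bump_run s N TT X C p \<longleftrightarrow> s \<le> N \<and>
     (\<forall>k. s \<le> k \<and> k < N \<longrightarrow> on_line (C k) k (p k) \<and> TT k (p k) = Some (X (Suc k)) \<and> X k < X (Suc k) \<and>
        (\<forall>q v. on_line (C k) k q \<longrightarrow> TT k q = Some v \<longrightarrow> X k < v \<longrightarrow> X (Suc k) \<le> v) \<and>
        C (Suc k) = (C k \<or> p k = (k, k))) \<and>
     (\<forall>k. s \<le> k \<and> k \<le> N \<longrightarrow> TT (Suc k) = place (TT k) (p k) (X k)) \<and>
     (\<forall>q v. on_line (C N) N q \<longrightarrow> TT N q = Some v \<longrightarrow> v \<le> X N) \<and>
     p N = line_end (TT N) (C N) N"

lemma bump_run_single:
  assumes "\<And>q v. on_line c s q \<Longrightarrow> T q = Some v \<Longrightarrow> v \<le> x"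
  shows "bump_run s s ((\<lambda>_. place T (line_end T c s) x)(s := T)) (\<lambda>_. x) (\<lambda>_. c) (\<lambda>_. line_end T c s)"
  using assms by (auto simp: bump_run_def)

lemma bump_run_Cons:
  assumes "bump_run (Suc s) N TT X C p"
    and "on_line c s q" "T q = Some (X (Suc s))" "x < X (Suc s)"
    and "\<And>q v. on_line c s q \<Longrightarrow> T q = Some v \<Longrightarrow> x < v \<Longrightarrow> X (Suc s) \<le> v"
    and "C (Suc s) = (c \<or> q = (s, s))" "TT (Suc s) = place T q x"
  shows "bump_run s N (TT(s := T)) (X(s := x)) (C(s := c)) (p(s := q))"
proof -
  have *: "s \<le> k \<longleftrightarrow> k = s \<or> Suc s \<le> k" for k by auto
  have "Suc s \<le> N" using assms(1) by (simp add: bump_run_def)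
  then show ?thesis using assms unfolding bump_run_def * by auto
qed

lemma finite_row_entries: "finite (dom T) \<Longrightarrow> finite (row_entries T i)"
  by (rule finite_subset[OF _ finite_imageI[of _ "\<lambda>q. the (T q)"]]) (force simp: row_entries_def image_iff)+

lemma finite_col_entries: "finite (dom T) \<Longrightarrow> finite (col_entries T i)"
  by (rule finite_subset[OF _ finite_imageI[of _ "\<lambda>q. the (T q)"]]) (force simp: col_entries_def image_iff)+

lemma hins_bump:
  assumes "finite (dom T)" "on_line c s q" "T q = Some v" "x < v"
  obtains y q where "on_line c s q" "T q = Some y" "x < y"
    "\<And>q v. on_line c s q \<Longrightarrow> T q = Some v \<Longrightarrow> x < v \<Longrightarrow> y \<le> v"
    "hins (Suc f) T x (if c then ColI s else RowI s) =
      hins f (place T q x) y (if c \<or> q = (s, s) then ColI (Suc s) else RowI (Suc s))"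
proof (cases c)
  case True
  let ?A = "{v \<in> col_entries T s. x < v}"
  define y where "y = Min ?A"
  define i where "i = (SOME i. T (i, s) = Some y)"
  have fin: "finite ?A" using finite_col_entries[OF assms(1)] by simp
  have v: "v \<in> ?A" using assms True by (cases q) (auto simp: on_line_def col_entries_def)
  then have "y \<in> ?A" unfolding y_def using Min_in[OF fin] by blast
  then have ex: "\<exists>i. T (i, s) = Some y" and "x < y" by (auto simp: col_entries_def)
  have i: "T (i, s) = Some y" unfolding i_def using ex by (rule someI_ex)
  have "y \<le> v" if "on_line c s q" "T q = Some v" "x < v" for q v
    unfolding y_def using that True by (intro Min_le fin) (cases q, auto simp: on_line_def col_entries_def)
  moreover have "(\<forall>v\<in>col_entries T s. v \<le> x) = False" using v by (auto simp: not_le)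
  then have "hins (Suc f) T x (if c then ColI s else RowI s) =
      hins f (place T (i, s) x) y (if c \<or> (i, s) = (s, s) then ColI (Suc s) else RowI (Suc s))"
    using True
    by (simp only: hins.simps imode.case if_True if_False Let_def y_def[symmetric] i_def[symmetric] place_def)
       simp
  ultimately show ?thesis using that[of "(i, s)" y] True i \<open>x < y\<close> by (simp add: on_line_def)
next
  case False
  let ?A = "{v \<in> row_entries T s. x < v}"
  define y where "y = Min ?A"
  define j where "j = (SOME j. T (s, j) = Some y)"
  have fin: "finite ?A" using finite_row_entries[OF assms(1)] by simp
  have v: "v \<in> ?A" using assms False by (cases q) (auto simp: on_line_def row_entries_def)
  then have "y \<in> ?A" unfolding y_def using Min_in[OF fin] by blast
  then have ex: "\<exists>j. T (s, j) = Some y" and "x < y" by (auto simp: row_entries_def)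
  have j: "T (s, j) = Some y" unfolding j_def using ex by (rule someI_ex)
  have "y \<le> v" if "on_line c s q" "T q = Some v" "x < v" for q v
    unfolding y_def using that False by (intro Min_le fin) (cases q, auto simp: on_line_def row_entries_def)
  moreover have "(\<forall>v\<in>row_entries T s. v \<le> x) = False" using v by (auto simp: not_le)
  then have "hins (Suc f) T x (if c then ColI s else RowI s) =
      hins f (place T (s, j) x) y (if c \<or> (s, j) = (s, s) then ColI (Suc s) else RowI (Suc s))"
    using False
    by (simp only: hins.simps imode.case if_True if_False Let_def y_def[symmetric] j_def[symmetric] place_def)
       (auto simp del: hins.simps)
  ultimately show ?thesis using that[of "(s, j)" y] False j \<open>x < y\<close> by (simp add: on_line_def)
qed

lemma hins_stop:
  assumes "\<And>q v. on_line c s q \<Longrightarrow> T q = Some v \<Longrightarrow> v \<le> x"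
  shows "hins (Suc f) T x (if c then ColI s else RowI s) = (place T (line_end T c s) x, outcome T c s x)"
proof (cases c)
  case True
  have "\<forall>v\<in>col_entries T s. v \<le> x" using assms True by (auto simp: on_line_def col_entries_def)
  then show ?thesis using True by (simp add: Let_def place_def outcome_def line_end_def)
next
  case False
  have "\<forall>v\<in>row_entries T s. v \<le> x" using assms False by (auto simp: on_line_def row_entries_def)
  then show ?thesis using False by (simp add: Let_def place_def outcome_def line_end_def)
qed

declare hins.simps(2) [simp del]

lemma inc_shifted_place: "inc_shifted T \<Longrightarrow> inc_shifted (place T q x)"
  by (simp add: place_def)

lemma dom_place: "q \<in> dom T \<Longrightarrow> dom (place T q x) = dom T"
  by (auto simp: place_def)

text \<open>Induction on the fuel. A bump on line \<open>s\<close> happens in a box of column at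
  least \<open>s\<close>, in row mode because boxes lie on or above the diagonal. So a bound on the
  columns alone leaves fuel for the terminating step; the sum \<open>s + f\<close> is
  invariant.\<close>

lemma hins_bump_run:
  assumes "inc_shifted T" "\<forall>(a, b)\<in>dom T. Suc b < s + f" "0 < f"
  shows "\<exists>N TT X C p. TT s = T \<and> X s = x \<and> C s = c \<and> bump_run s N TT X C p \<and>
    hins f T x (if c then ColI s else RowI s) = (TT (Suc N), outcome (TT N) (C N) N (X N))"
  using assms
proof (induction f arbitrary: T x c s)
  case (Suc f)
  note inc = Suc.prems(1)
  show ?case
  proof (cases "\<exists>q v. on_line c s q \<and> T q = Some v \<and> x < v")
    case True
    then obtain q0 v0 where q0: "on_line c s q0" "T q0 = Some v0" "x < v0" by blast
    obtain y q where q: "on_line c s q" "T q = Some y" "x < y"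
      "\<And>q v. on_line c s q \<Longrightarrow> T q = Some v \<Longrightarrow> x < v \<Longrightarrow> y \<le> v"
      "hins (Suc f) T x (if c then ColI s else RowI s) =
        hins f (place T q x) y (if c \<or> q = (s, s) then ColI (Suc s) else RowI (Suc s))"
      by (rule hins_bump[OF inc_shifted_finite[OF inc] q0, where f = f]) (rule that; assumption)
    have dom: "dom (place T q x) = dom T" by (simp add: q(2) dom_place domIff)
    obtain a b where ab: "q = (a, b)" by (cases q)
    have abT: "(a, b) \<in> dom T" using q(2) ab by (simp add: domI)
    have "s \<le> b"
      using inc_shifted_pos[OF inc abT] q(1) ab by (simp add: on_line_def split: if_splits)
    moreover have "Suc b < s + Suc f" using bspec[OF Suc.prems(2) abT] by simp
    ultimately have f: "0 < f" by linarith
    have "\<forall>(a, b)\<in>dom (place T q x). Suc b < Suc s + f"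
      using Suc.prems(2) unfolding dom by simp
    from Suc.IH[OF inc_shifted_place[OF inc] this f, of y "c \<or> q = (s, s)"]
    obtain N TT X C p where IH: "TT (Suc s) = place T q x" "X (Suc s) = y"
      "C (Suc s) = (c \<or> q = (s, s))" "bump_run (Suc s) N TT X C p"
      "hins f (place T q x) y (if c \<or> q = (s, s) then ColI (Suc s) else RowI (Suc s))
        = (TT (Suc N), outcome (TT N) (C N) N (X N))"
      by (elim exE conjE) (rule that; assumption)
    have N: "Suc s \<le> N" using IH(4) by (simp add: bump_run_def)
    have "bump_run s N (TT(s := T)) (X(s := x)) (C(s := c)) (p(s := q))"
      using q IH by (intro bump_run_Cons) auto
    then show ?thesis
      using N IH(5) q(5)
      by (intro exI[of _ N] exI[of _ "TT(s := T)"] exI[of _ "X(s := x)"] exI[of _ "C(s := c)"] exI[of _ "p(s := q)"])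
        (auto simp: fun_upd_same fun_upd_other simp del: fun_upd_apply)
  next
    case False
    then have stop: "v \<le> x" if "on_line c s q" "T q = Some v" for q v using that by (meson not_le)
    show ?thesis
      using bump_run_single[of c s T x, OF stop] hins_stop[of c s T x f, OF stop]
      by (intro exI[of _ s] exI[of _ "(\<lambda>_. place T (line_end T c s) x)(s := T)"] exI[of _ "\<lambda>_. x"] exI[of _ "\<lambda>_. c"]
          exI[of _ "\<lambda>_. line_end T c s"])
        (auto simp: fun_upd_same fun_upd_other simp del: fun_upd_apply)
  qed
qed simp

text \<open>A box in column \<open>b\<close> forces the first \<open>b\<close> boxes of row 1. This
  justifies the amount of fuel in \<open>hecke_insert\<close>.\<close>

lemma col_le_card:
  assumes "inc_shifted T" "(a, b) \<in> dom T"
  shows "b \<le> card (dom T)"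
proof -
  have "(1, j) \<in> dom T" if "j \<in> {1..b}" for j
    using inc_shifted_down[OF assms, of 1 j] inc_shifted_pos[OF assms] that by simp
  then have "Pair 1 ` {1..b} \<subseteq> dom T" by blast
  from card_mono[OF inc_shifted_finite[OF assms(1)] this] show ?thesis
    by (simp add: card_image inj_on_def)
qed

locale hecke_run =
  fixes T T' :: tab and b :: "nat \<times> nat" and pr :: bool
    and N :: nat and TT :: "nat \<Rightarrow> tab" and X :: "nat \<Rightarrow> nat" and C :: "nat \<Rightarrow> bool" and p :: "nat \<Rightarrow> nat \<times> nat"
  assumes inc_T: "inc_shifted T"
    and start: "TT 1 = T" "\<not> C 1"
    and run: "bump_run 1 N TT X C p"
    and result: "T' = TT (Suc N)" "(b, pr) = outcome (TT N) (C N) N (X N)"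

lemma hecke_insert_run:
  assumes "inc_shifted T" "hecke_insert T x = (T', b, pr)"
  obtains N TT X C p where "hecke_run T T' b pr N TT X C p" "X 1 = x"
proof -
  have "\<forall>(a, b)\<in>dom T. Suc b < 1 + (2 * card (dom T) + 3)"
    using col_le_card[OF assms(1)] by fastforce
  from hins_bump_run[OF assms(1) this, of x False] assms(2)
  obtain N TT X C p where "TT 1 = T" "X 1 = x" "\<not> C 1" "bump_run 1 N TT X C p"
    "(T', b, pr) = (TT (Suc N), outcome (TT N) (C N) N (X N))"
    unfolding hecke_insert_def by auto
  then show ?thesis using that assms(1) unfolding hecke_run_def by blast
qed

subsection \<open>Bumping paths\<close>

context hecke_run
begin

lemma N1: "1 \<le> N"
  using run by (simp add: bump_run_def)

lemma bump:
  assumes "1 \<le> k" "k < N"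
  shows bump_line: "on_line (C k) k (p k)"
    and bump_TT: "TT k (p k) = Some (X (Suc k))"
    and X_less_Suc: "X k < X (Suc k)"
    and bump_min: "on_line (C k) k q \<Longrightarrow> TT k q = Some v \<Longrightarrow> X k < v \<Longrightarrow> X (Suc k) \<le> v"
    and C_Suc: "C (Suc k) \<longleftrightarrow> C k \<or> p k = (k, k)"
  using run assms unfolding bump_run_def by blast+

lemma TT_Suc: "1 \<le> k \<Longrightarrow> k \<le> N \<Longrightarrow> TT (Suc k) = place (TT k) (p k) (X k)"
  using run unfolding bump_run_def by blast

lemma TT_stop: "on_line (C N) N q \<Longrightarrow> TT N q = Some v \<Longrightarrow> v \<le> X N"
  using run unfolding bump_run_def by blast

lemma TT_Suc_other: "1 \<le> k \<Longrightarrow> k \<le> N \<Longrightarrow> q \<noteq> p k \<Longrightarrow> TT (Suc k) q = TT k q"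
  by (simp add: TT_Suc place_def)

lemma TT_Suc_bump: "1 \<le> k \<Longrightarrow> k \<le> N \<Longrightarrow> TT (Suc k) (p k) = Some (X k) \<or> TT (Suc k) (p k) = TT k (p k)"
  by (simp add: TT_Suc place_def)

lemma inc_TT: "1 \<le> k \<Longrightarrow> k \<le> Suc N \<Longrightarrow> inc_shifted (TT k)"
proof (induction k rule: nat_induct_at_least)
  case base
  then show ?case using inc_T start(1) by simp
next
  case (Suc k)
  then show ?case by (simp add: TT_Suc inc_shifted_place)
qed

lemma inc_T': "inc_shifted T'"
  using inc_TT[of "Suc N"] result(1) by simp

text \<open>Every step before the last hits an occupied box, so only step \<open>N\<close> can
  change the shape.\<close>

lemma dom_TT: "1 \<le> k \<Longrightarrow> k \<le> N \<Longrightarrow> dom (TT k) = dom T"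
proof (induction k rule: nat_induct_at_least)
  case base
  then show ?case using start(1) by simp
next
  case (Suc k)
  have "p k \<in> dom (TT k)" using bump_TT[of k] Suc.hyps Suc.prems by (simp add: domIff)
  then show ?case using Suc TT_Suc[of k] by (simp add: dom_place del: domIff)
qed

lemma X_mono:
  assumes "1 \<le> i" "i \<le> j" "j \<le> N"
  shows "X i \<le> X j"
  using assms(2,1,3)
proof (induction j rule: dec_induct)
  case (step j)
  then show ?case using X_less_Suc[of j] by simp
qed simp

lemma C_mono:
  assumes "1 \<le> i" "i \<le> j" "j \<le> N" "C i"
  shows "C j"
  using assms(2,1,3,4)
proof (induction j rule: dec_induct)
  case (step j)
  then show ?case using C_Suc[of j] by simp
qed simp

text \<open>The inserted values increase along a run, so step \<open>k\<close> only looks at entries that earlier steps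
  did not touch: the whole run can be read off the initial tableau.\<close>
lemma TT_above: "1 \<le> k \<Longrightarrow> k \<le> N \<Longrightarrow> X k < v \<Longrightarrow> TT k q = Some v \<longleftrightarrow> T q = Some v"
proof (induction k rule: nat_induct_at_least)
  case base
  then show ?case using start(1) by simp
next
  case (Suc k)
  have k: "1 \<le> k" "k < N" "k \<le> N" using Suc.hyps Suc.prems by simp_all
  have lt: "X k < v" using X_less_Suc[OF k(1,2)] Suc.prems by simp
  have "TT (Suc k) q = Some v \<longleftrightarrow> TT k q = Some v"
  proof (cases "q = p k")
    case True
    then show ?thesis
      using TT_Suc_bump[OF k(1,3)] bump_TT[OF k(1,2)] lt Suc.prems by auto
  next
    case False
    then show ?thesis using TT_Suc_other[OF k(1,3)] by simp
  qed
  then show ?case using Suc.IH k lt by simp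
qed

lemma T_bump: "1 \<le> k \<Longrightarrow> k < N \<Longrightarrow> T (p k) = Some (X (Suc k))"
  using bump_TT[of k] X_less_Suc[of k] TT_above[of k "X (Suc k)" "p k"] by simp

lemma T_min: "1 \<le> k \<Longrightarrow> k < N \<Longrightarrow> on_line (C k) k q \<Longrightarrow> T q = Some v \<Longrightarrow> X k < v \<Longrightarrow> X (Suc k) \<le> v"
  using bump_min[of k q v] TT_above[of k v q] by simp

lemma T_stop: "on_line (C N) N q \<Longrightarrow> T q = Some v \<Longrightarrow> v \<le> X N"
  using TT_stop[of q v] TT_above[of N v q] N1 by (meson le_refl not_le)

lemma p_N: "p N = line_end T (C N) N"
proof -
  have "dom (TT N) = dom T" using dom_TT N1 by blast
  moreover have "p N = line_end (TT N) (C N) N" using run by (simp add: bump_run_def)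
  ultimately show ?thesis unfolding line_end_def row_end_def col_end_def by simp
qed

lemma end_row:
  assumes "\<not> C N"
  obtains j where "p N = (N, j)" "N \<le> j" "\<And>j'. (N, j') \<in> dom T \<longleftrightarrow> N \<le> j' \<and> j' < j"
  using row_end_iff[OF inc_T N1] p_N assms by (metis line_end_def)

lemma end_col:
  assumes "C N"
  obtains i where "p N = (i, N)" "1 \<le> i" "\<And>i'. (i', N) \<in> dom T \<longleftrightarrow> 1 \<le> i' \<and> i' < i"
  using col_end_iff[OF inc_T, of N] p_N assms by (metis line_end_def)

lemma p_N_notin: "p N \<notin> dom T"
  by (cases "C N") (metis end_col end_row less_irrefl)+

lemma p_in: "1 \<le> k \<Longrightarrow> k < N \<Longrightarrow> p k \<in> dom T"
  using T_bump[of k] by (simp add: domIff)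

lemma p_row: "1 \<le> k \<Longrightarrow> k \<le> N \<Longrightarrow> \<not> C k \<Longrightarrow> fst (p k) = k"
  using bump_line[of k] end_row by (cases "k = N") (force simp: on_line_def)+

lemma p_col: "1 \<le> k \<Longrightarrow> k \<le> N \<Longrightarrow> C k \<Longrightarrow> snd (p k) = k"
  using bump_line[of k] end_col by (cases "k = N") (force simp: on_line_def)+

section \<open>Geometry of the boxes hit along a path\<close>

lemma before_row:
  assumes k: "1 \<le> k" "k \<le> N" and row: "\<not> C k" and j: "k \<le> j" "j < snd (p k)"
  obtains v where "T (k, j) = Some v" "v \<le> X k"
proof -
  have pk: "p k = (k, snd (p k))" using p_row[OF k row] by (metis prod.collapse)
  have in_T: "(k, j) \<in> dom T"
  proof (cases "k = N")
    case True
    then show ?thesis using end_row row j by (metis snd_conv)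
  next
    case False
    then have "(k, snd (p k)) \<in> dom T" using p_in[of k] k pk by simp
    then show ?thesis using inc_shifted_down[OF inc_T _ k(1), of k "snd (p k)" j] j by simp
  qed
  then obtain v where v: "T (k, j) = Some v" by blast
  have "v \<le> X k"
  proof (cases "k = N")
    case True
    then show ?thesis using T_stop[of "(k, j)" v] v row by (simp add: on_line_def)
  next
    case False
    then have kN: "k < N" using k by simp
    have "v < X (Suc k)"
      using inc_shifted_mono(2)[OF inc_T v, of k "snd (p k)" "X (Suc k)"] T_bump[OF k(1) kN] pk j
      by (metis le_refl less_imp_le less_irrefl prod.inject)
    then show ?thesis using T_min[OF k(1) kN, of "(k, j)" v] v row
      by (force simp: on_line_def)
  qed
  then show thesis using that v by blast
qed

lemma before_col:
  assumes k: "1 \<le> k" "k \<le> N" and col: "C k" and i: "1 \<le> i" "i < fst (p k)"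
  obtains v where "T (i, k) = Some v" "v \<le> X k"
proof -
  have pk: "p k = (fst (p k), k)" using p_col[OF k col] by (metis prod.collapse)
  have in_T: "(i, k) \<in> dom T"
  proof (cases "k = N")
    case True
    then show ?thesis using end_col col i by (metis fst_conv)
  next
    case False
    then have in_p: "(fst (p k), k) \<in> dom T" using p_in[of k] k pk by simp
    then have "fst (p k) \<le> k" using inc_shifted_pos[OF inc_T] by blast
    then show ?thesis using inc_shifted_down[OF inc_T in_p i(1), of k] i by simp
  qed
  then obtain v where v: "T (i, k) = Some v" by blast
  have "v \<le> X k"
  proof (cases "k = N")
    case True
    then show ?thesis using T_stop[of "(i, k)" v] v col by (simp add: on_line_def)
  next
    case False
    then have kN: "k < N" using k by simp
    have "v < X (Suc k)"
      using inc_shifted_mono(2)[OF inc_T v, of "fst (p k)" k "X (Suc k)"] T_bump[OF k(1) kN] pk i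
      by (metis le_refl less_imp_le less_irrefl prod.inject)
    then show ?thesis using T_min[OF k(1) kN, of "(i, k)" v] v col
      by (force simp: on_line_def)
  qed
  then show thesis using that v by blast
qed

lemma turn_snd: "1 \<le> k \<Longrightarrow> k < N \<Longrightarrow> C (Suc k) \<Longrightarrow> snd (p k) = k"
  using C_Suc[of k] p_col[of k] by force

text \<open>If the path moved down, column k + 1 would have an entry at most
  \<open>X (Suc k)\<close> directly to the right of the box of \<open>T\<close> that holds
  \<open>X (Suc k)\<close>.\<close>

lemma next_col:
  assumes k: "1 \<le> k" "k < N" and col: "C (Suc k)"
  shows "fst (p (Suc k)) \<le> fst (p k)"
proof (rule ccontr)
  assume less: "\<not> ?thesis"
  have pk: "T (fst (p k), k) = Some (X (Suc k))"
    using T_bump[OF k] turn_snd[OF k col] by (metis prod.collapse)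
  then have pos: "1 \<le> fst (p k)" using inc_shifted_pos[OF inc_T domI] by blast
  obtain v where v: "T (fst (p k), Suc k) = Some v" "v \<le> X (Suc k)"
    using before_col[of "Suc k" "fst (p k)"] k col less pos by auto
  show False using inc_shifted_mono(2)[OF inc_T pk v(1)] v(2) by simp
qed

lemma row_snd:
  assumes k: "1 \<le> k" "k < N" and row: "\<not> C (Suc k)"
  shows "fst (p k) = k" "Suc k \<le> snd (p k)"
proof -
  have C: "\<not> C k" "p k \<noteq> (k, k)" using C_Suc[OF k] row by auto
  show f: "fst (p k) = k" using p_row[of k] k C by simp
  have "k \<le> snd (p k)" using inc_shifted_pos[OF inc_T] p_in[OF k] f by (metis prod.collapse)
  moreover have "snd (p k) \<noteq> k" using C(2) f by (metis prod.collapse)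
  ultimately show "Suc k \<le> snd (p k)" by simp
qed

text \<open>The transposed argument. Since the path has not turned, \<open>row_snd\<close> puts the
  hit box off the diagonal, so the position below it is on or above the diagonal.\<close>

lemma next_row:
  assumes k: "1 \<le> k" "k < N" and row: "\<not> C (Suc k)"
  shows "snd (p (Suc k)) \<le> snd (p k)"
proof (rule ccontr)
  assume less: "\<not> ?thesis"
  note rs = row_snd[OF k row]
  have pk: "T (k, snd (p k)) = Some (X (Suc k))"
    using T_bump[OF k] rs(1) by (metis prod.collapse)
  obtain v where v: "T (Suc k, snd (p k)) = Some v" "v \<le> X (Suc k)"
    using before_row[of "Suc k" "snd (p k)"] k row less rs by auto
  show False using inc_shifted_mono(2)[OF inc_T pk v(1)] v(2) by simp
qed

text \<open>For a bumped box this is closure of the shape. For the box behind the last line, the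
  neighbour on the preceding line exists because the path moves weakly left in rows and weakly up in
  columns.\<close>

lemma addable:
  assumes k: "1 \<le> k" "k \<le> N" and pk: "p k = (i, j)"
  shows "1 \<le> i \<and> i \<le> j \<and> (j = i \<or> (i, j - 1) \<in> dom T) \<and> (i = 1 \<or> (i - 1, j) \<in> dom T)"
proof (cases "k = N")
  case False
  then have ij: "(i, j) \<in> dom T" using p_in[of k] k pk by simp
  note pos = inc_shifted_pos[OF inc_T ij]
  have "(i, j - 1) \<in> dom T" if "j \<noteq> i"
    by (rule inc_shifted_down[OF inc_T ij]) (use pos that in linarith)+
  moreover have "(i - 1, j) \<in> dom T" if "i \<noteq> 1"
    by (rule inc_shifted_down[OF inc_T ij]) (use pos that in linarith)+
  ultimately show ?thesis using pos by blast
next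
  case True
  show ?thesis
  proof (cases "C N")
    case row: False
    obtain j' where j': "p N = (N, j')" "N \<le> j'" "\<And>j''. (N, j'') \<in> dom T \<longleftrightarrow> N \<le> j'' \<and> j'' < j'"
      by (rule end_row[OF row]) (rule that; assumption)
    have ij: "i = N" "j' = j" using j' pk True by auto
    have "(N - 1, j) \<in> dom T" if "N \<noteq> 1"
    proof -
      have k': "1 \<le> N - 1" "N - 1 < N" "Suc (N - 1) = N" using N1 that by simp_all
      have "p (N - 1) = (N - 1, snd (p (N - 1)))"
        using row_snd(1)[OF k'(1,2)] k'(3) row by (metis prod.collapse)
      then have "(N - 1, snd (p (N - 1))) \<in> dom T" using p_in[OF k'(1,2)] by simp
      moreover have "j \<le> snd (p (N - 1))" using next_row[OF k'(1,2)] k'(3) row j' ij by simp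
      ultimately show ?thesis using inc_shifted_down[OF inc_T _ k'(1)] j' ij by (meson diff_le_self le_trans order_refl)
    qed
    then show ?thesis using j'(2) j'(3)[of "j - 1"] ij N1 by (cases "j = N") auto
  next
    case col: True
    obtain i' where i': "p N = (i', N)" "1 \<le> i'" "\<And>i''. (i'', N) \<in> dom T \<longleftrightarrow> 1 \<le> i'' \<and> i'' < i'"
      by (rule end_col[OF col]) (rule that; assumption)
    have ij: "i' = i" "j = N" using i' pk True by auto
    have "N \<noteq> 1" using col start(2) by blast
    then have k': "1 \<le> N - 1" "N - 1 < N" "Suc (N - 1) = N" using N1 by simp_all
    have "p (N - 1) = (fst (p (N - 1)), N - 1)"
      using turn_snd[OF k'(1,2)] k'(3) col by (metis prod.collapse)
    then have in_T: "(fst (p (N - 1)), N - 1) \<in> dom T" using p_in[OF k'(1,2)] by simp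
    have i: "i \<le> fst (p (N - 1))" using next_col[OF k'(1,2)] k'(3) col i' ij by simp
    note pos = inc_shifted_pos[OF inc_T in_T]
    have "(i, N - 1) \<in> dom T"
      by (rule inc_shifted_down[OF inc_T in_T]) (use pos i i' ij in linarith)+
    moreover have "i = 1 \<or> (i - 1, N) \<in> dom T" using i'(2) i'(3)[of "i - 1"] ij by (cases "i = 1") auto
    ultimately show ?thesis using i' ij pos i by (simp del: domIff)
  qed
qed

section \<open>Traces of the run in the resulting tableau\<close>

text \<open>A later step m bumps \<open>X (Suc m)\<close>, which exceeds \<open>X m\<close> and
  hence \<open>v\<close>, or it hits a box outside the shape; either way \<open>v\<close>
  stays.\<close>

lemma T'_persist:
  assumes k: "1 \<le> k" "k \<le> N" and v: "TT (Suc k) q = Some v" "v \<le> X (Suc k) \<or> k = N"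
  shows "T' q = Some v"
proof -
  have "m \<le> Suc N \<Longrightarrow> TT m q = Some v" if "Suc k \<le> m" for m
    using that
  proof (induction m rule: dec_induct)
    case (step m)
    have m: "1 \<le> m" "m \<le> N" using step.hyps step.prems k by simp_all
    have "v \<le> X m" using v(2) X_mono[of "Suc k" m] step.hyps m by auto
    have TTm: "TT m q = Some v" using step by simp
    have "q \<noteq> p m"
    proof (cases "m = N")
      case True
      have "dom (TT N) = dom T" by (rule dom_TT) (use N1 in simp_all)
      then have "q \<in> dom T" using TTm True by blast
      then show ?thesis using p_N_notin True by blast
    next
      case False
      then show ?thesis using bump_TT[of m] X_less_Suc[of m] m TTm \<open>v \<le> X m\<close> by auto
    qed
    then show ?case using TT_Suc_other[OF m] TTm by simp
  qed (use v in simp)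
  then show ?thesis using result(1) k by simp
qed

text \<open>A value that cannot be put into its box is blocked by an equal value in the box to the left or above.\<close>
lemma trace:
  assumes k: "1 \<le> k" "k \<le> N" and pk: "p k = (i, j)"
  shows "T' (i, j) = Some (X k) \<or>
    T' (i, j) = T (i, j) \<and> (T' (i, j - 1) = Some (X k) \<or> T' (i - 1, j) = Some (X k))"
proof (cases "inc_shifted ((TT k)(p k \<mapsto> X k))")
  case True
  then have "TT (Suc k) (p k) = Some (X k)" using TT_Suc[OF k] by (simp add: place_def)
  then have "T' (p k) = Some (X k)"
    by (rule T'_persist[OF k]) (use X_less_Suc[of k] k in force)
  then show ?thesis using pk by simp
next
  case False
  then have TT: "TT (Suc k) = TT k" using TT_Suc[OF k] by (simp add: place_def)
  have inc: "inc_shifted (TT k)" using inc_TT k by simp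
  note dom = dom_TT[OF k] and ad = addable[OF k pk]
  \<comment> \<open>At the last step there is no box weakly to the right and below, since the hit
    box is outside the shape.\<close>
  have bound: "X k < v" if "q \<noteq> (i, j)" "i \<le> fst q" "j \<le> snd q" "TT k q = Some v" for q v
  proof (cases "k = N")
    case kN: True
    have "q \<in> dom T" using that(4) dom by blast
    then have "(i, j) \<in> dom T" using inc_shifted_down[OF inc_T, of "fst q" "snd q" i j] that ad by simp
    then show ?thesis using p_N_notin pk kN by simp
  next
    case kN: False
    have "X (Suc k) < v"
      using inc_shifted_mono(2)[OF inc, of i j "X (Suc k)" "fst q" "snd q" v] that bump_TT[of k] k kN pk by simp
    then show ?thesis using X_less_Suc[of k] k kN by simp
  qed
  have "(\<exists>v\<ge>X k. TT k (i, j - 1) = Some v) \<or> (\<exists>v\<ge>X k. TT k (i - 1, j) = Some v)"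
  proof (rule not_inc_shifted_upd[OF inc])
    show "X k < v" if "j < j'" "TT k (i, j') = Some v" for j' v
      by (rule bound[of "(i, j')"]) (use that in simp_all)
    show "X k < v" if "i < i'" "TT k (i', j) = Some v" for i' v
      by (rule bound[of "(i', j)"]) (use that in simp_all)
  qed (use ad dom False pk in simp_all)
  \<comment> \<open>A blocking neighbour holds at least \<open>X k\<close>, so this makes it equal.
    On the current line the bound comes from the choice of the hit box. On the preceding line, the
    box hit there lies weakly beyond the neighbour and now holds at most \<open>X k\<close>.\<close>
  moreover have prev: "v \<le> X k"
    if "q = (i, j - 1) \<or> q = (i - 1, j)" "TT k q = Some v" for q v
  proof (rule ccontr)
    assume v: "\<not> v \<le> X k"
    then have Tv: "T q = Some v" using TT_above[OF k] that by simp
    then have q: "q \<in> dom T" by blast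
    show False
    proof (cases "C k")
      case row: False
      have ik: "i = k" using p_row[OF k row] pk by simp
      show False
      proof (cases "q = (i, j - 1)")
        case True
        then have "k \<le> j - 1" "1 \<le> k" using inc_shifted_pos[OF inc_T, of i "j - 1"] q ik by simp_all
        then show False
          using before_row[OF k row, of "j - 1" False] Tv True pk ik v by fastforce
      next
        case False
        then have qi: "q = (i - 1, j)" using that by blast
        then have k': "1 \<le> k - 1" "k - 1 < N" "Suc (k - 1) = k" "k - 1 \<le> N"
          using inc_shifted_pos[OF inc_T, of "i - 1" j] q ik k by simp_all
        have pk': "p (k - 1) = (k - 1, snd (p (k - 1)))"
          using row_snd(1)[OF k'(1,2)] k'(3) row by (metis prod.collapse)
        have le: "j \<le> snd (p (k - 1))" using next_row[OF k'(1,2)] k'(3) row pk by simp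
        obtain u where u: "TT k (p (k - 1)) = Some u" "u \<le> X k"
          using TT_Suc_bump[OF k'(1,4)] bump_TT[OF k'(1,2)] X_less_Suc[OF k'(1,2)] k'(3) by force
        have "v \<le> u"
          using inc_shifted_mono(1)[OF inc, of "k - 1" j v "k - 1" "snd (p (k - 1))" u] that(2) u(1) pk' le qi ik
          by simp
        then show False using u v by simp
      qed
    next
      case col: True
      have jk: "j = k" using p_col[OF k col] pk by simp
      show False
      proof (cases "q = (i - 1, j)")
        case True
        then have "1 \<le> i - 1" using inc_shifted_pos[OF inc_T, of "i - 1" j] q by simp
        then show False
          using before_col[OF k col, of "i - 1" False] Tv True pk jk v by fastforce
      next
        case False
        then have qi: "q = (i, j - 1)" using that by blast
        then have k': "1 \<le> k - 1" "k - 1 < N" "Suc (k - 1) = k" "k - 1 \<le> N"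
          using inc_shifted_pos[OF inc_T, of i "j - 1"] q jk k by simp_all
        have pk': "p (k - 1) = (fst (p (k - 1)), k - 1)"
          using turn_snd[OF k'(1,2)] k'(3) col by (metis prod.collapse)
        have le: "i \<le> fst (p (k - 1))" using next_col[OF k'(1,2)] k'(3) col pk by simp
        obtain u where u: "TT k (p (k - 1)) = Some u" "u \<le> X k"
          using TT_Suc_bump[OF k'(1,4)] bump_TT[OF k'(1,2)] X_less_Suc[OF k'(1,2)] k'(3) by force
        have "v \<le> u"
          using inc_shifted_mono(1)[OF inc, of i "k - 1" v "fst (p (k - 1))" "k - 1" u] that(2) u(1) pk' le qi jk
          by simp
        then show False using u v by simp
      qed
    qed
  qed
  ultimately have "TT (Suc k) (i, j - 1) = Some (X k) \<or> TT (Suc k) (i - 1, j) = Some (X k)"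
    unfolding TT using prev by (metis le_antisym)
  then have "T' (i, j - 1) = Some (X k) \<or> T' (i - 1, j) = Some (X k)"
    using T'_persist[OF k, of _ "X k"] X_less_Suc[of k] k by (cases "k = N") auto
  moreover have "T' (i, j) = T (i, j)"
  proof (cases "k = N")
    case kN: True
    have "(i, j) \<notin> dom T" using p_N_notin pk kN by simp
    then have "TT N (i, j) = None" using dom kN by (metis domIff)
    then show ?thesis using TT result(1) kN \<open>(i, j) \<notin> dom T\<close> by (simp add: domIff)
  next
    case kN: False
    then have "TT (Suc k) (i, j) = Some (X (Suc k))" using TT bump_TT[of k] k pk by simp
    then show ?thesis using T'_persist[OF k, of "(i, j)" "X (Suc k)"] T_bump[of k] k kN pk by simp
  qed
  ultimately show ?thesis by blast
qed

lemma T'_cases: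
  obtains "T' q = T q" | k where "1 \<le> k" "k \<le> N" "q = p k" "T' q = Some (X k)"
proof -
  have "m \<le> Suc N \<Longrightarrow> TT m q = T q \<or> (\<exists>k. 1 \<le> k \<and> k \<le> N \<and> q = p k \<and> TT m q = Some (X k))" if "1 \<le> m" for m
    using that
  proof (induction m rule: nat_induct_at_least)
    case base
    then show ?case using start(1) by simp
  next
    case (Suc m)
    then have m: "1 \<le> m" "m \<le> N" by simp_all
    show ?case using Suc TT_Suc_other[OF m, of q] TT_Suc_bump[OF m] m by (cases "q = p m") auto
  qed
  from this[of "Suc N"] result(1) that show thesis by auto
qed

lemma T'_le:
  assumes "T q = Some u"
  obtains v where "T' q = Some v" "v \<le> u"
proof (cases rule: T'_cases[of q])
  case 1
  then show thesis using that assms by simp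
next
  case (2 k)
  then have "k \<noteq> N" using p_N_notin assms by blast
  then show thesis using that 2 assms T_bump[of k] X_less_Suc[of k] by simp
qed

text \<open>A changed entry is some \<open>X l\<close>, and exceeding \<open>X k\<close> forces l >
  k.\<close>

lemma T'_above:
  assumes "1 \<le> k" "k \<le> N" "T' q = Some v" "X k < v"
  shows "T q = Some v \<or> k < N \<and> X (Suc k) \<le> v"
proof (cases rule: T'_cases[of q])
  case 1
  then show ?thesis using assms by simp
next
  case (2 l)
  then have "k < l" using assms X_mono[of l k] by (metis not_le option.inject)
  then show ?thesis using 2 assms X_mono[of "Suc k" l] by auto
qed

section \<open>Where the run terminates\<close>

lemma placed:
  assumes "inc_shifted ((TT N)(p N \<mapsto> X N))"
  shows "T' (p N) = Some (X N)" "b = p N" "pr = C N" "dom T' = insert (p N) (dom T)"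
proof -
  have "p N = line_end (TT N) (C N) N" using run by (simp add: bump_run_def)
  then show "b = p N" "pr = C N" using result(2) assms by (simp_all add: outcome_def)
  have "T' = (TT N)(p N \<mapsto> X N)" using result(1) TT_Suc[of N] N1 assms by (simp add: place_def)
  then show "T' (p N) = Some (X N)" "dom T' = insert (p N) (dom T)" using dom_TT[of N] N1 by simp_all
qed

lemma not_placed:
  assumes "\<not> inc_shifted ((TT N)(p N \<mapsto> X N))"
  shows "dom T' = dom T"
    "(b, pr) = (if C N then (rightmost T' (fst (bottom T' N)), True)
      else if row_entries T' N \<noteq> {} then (bottom T' (snd (rightmost T' N)), False)
      else (rightmost T' (N - 1), True))"
proof -
  have T': "T' = TT N" using result(1) TT_Suc[of N] N1 assms by (simp add: place_def)
  show "dom T' = dom T" using T' dom_TT[of N] N1 by simp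
  have "p N = line_end (TT N) (C N) N" using run by (simp add: bump_run_def)
  then show "(b, pr) = (if C N then (rightmost T' (fst (bottom T' N)), True)
      else if row_entries T' N \<noteq> {} then (bottom T' (snd (rightmost T' N)), False)
      else (rightmost T' (N - 1), True))"
    using result(2) assms unfolding T' by (simp add: outcome_def)
qed

text \<open>From here on \<open>p N \<in> dom T'\<close> is the test for an added box, instead of a
  condition on the intermediate tableau \<open>TT N\<close>.\<close>

lemma dom_new: "p N \<in> dom T' \<Longrightarrow> dom T' = insert (p N) (dom T)"
  using placed(4) not_placed(1) p_N_notin by metis

lemma dom_not_new: "p N \<notin> dom T' \<Longrightarrow> dom T' = dom T"
  using placed(4) not_placed(1) by (metis insertI1)

lemma new:
  assumes "p N \<in> dom T'"
  shows "T' (p N) = Some (X N)" "b = p N" "pr = C N"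
  using placed not_placed(1) p_N_notin assms by metis+

lemma not_new:
  assumes "p N \<notin> dom T'"
  shows "(b, pr) = (if C N then (rightmost T' (fst (bottom T' N)), True)
      else if row_entries T' N \<noteq> {} then (bottom T' (snd (rightmost T' N)), False)
      else (rightmost T' (N - 1), True))"
  using placed(4) not_placed(2) assms by (metis insertI1)

lemma dom_mono: "q \<in> dom T \<Longrightarrow> q \<in> dom T'"
  using dom_new dom_not_new by (metis insertI2)

text \<open>A box to the right or below would by closure have forced the added box into the old
  shape.\<close>

lemma new_corner:
  assumes "p N \<in> dom T'"
  shows "(fst (p N), Suc (snd (p N))) \<notin> dom T'" "(Suc (fst (p N)), snd (p N)) \<notin> dom T'"
proof -
  obtain i j where ij: "p N = (i, j)" by (cases "p N")
  have pos: "1 \<le> i" "i \<le> j" using addable[OF N1 le_refl ij] by auto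
  have "(i, Suc j) \<notin> dom T"
  proof
    assume *: "(i, Suc j) \<in> dom T"
    have "(i, j) \<in> dom T" by (rule inc_shifted_down[OF inc_T *]) (use pos in simp_all)
    then show False using p_N_notin ij by simp
  qed
  moreover have "(Suc i, j) \<notin> dom T"
  proof
    assume *: "(Suc i, j) \<in> dom T"
    have "(i, j) \<in> dom T" by (rule inc_shifted_down[OF inc_T *]) (use pos in simp_all)
    then show False using p_N_notin ij by simp
  qed
  ultimately show "(fst (p N), Suc (snd (p N))) \<notin> dom T'" "(Suc (fst (p N)), snd (p N)) \<notin> dom T'"
    unfolding dom_new[OF assms] using ij by (simp_all del: domIff)
qed

lemma new_rightmost:
  assumes "p N \<in> dom T'"
  shows "rightmost T' (fst (p N)) = p N"
  using rightmost_eq[OF inc_T', of "fst (p N)" "snd (p N)"] new_corner[OF assms] assms by simp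

text \<open>An added box is a corner and so ends its row; every other primed outcome is a
  \<open>rightmost\<close> by definition. Hence in a fixed shape the row determines a primed
  termination box.\<close>

lemma primed_rightmost: "pr \<Longrightarrow> b = rightmost T' (fst b)"
proof (cases "p N \<in> dom T'")
  case True
  then show ?thesis using new_rightmost new(2) by simp
next
  case False
  assume pr
  then show ?thesis using not_new[OF False] by (auto split: if_splits)
qed

text \<open>Rules out that column insertion fails in an empty column, where \<^const>\<open>bottom\<close> would be the
  \<^const>\<open>Max\<close> of the empty set.\<close>
lemma row1_replaced:
  "1 \<le> k \<Longrightarrow> k \<le> N \<Longrightarrow> C k \<or> p k = (k, k) \<Longrightarrow> fst (p k) = 1 \<Longrightarrow> T' (p k) = Some (X k)"
proof (induction k rule: nat_induct_at_least)
  case base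
  have "p 1 = (1, 1)" using base start(2) by simp
  moreover have "(1, 0) \<notin> dom T'" "(0, 1) \<notin> dom T'" using inc_shifted_pos[OF inc_T'] by force+
  ultimately show ?case using trace[OF le_refl N1, of 1 1] by (simp add: domIff)
next
  case (Suc k)
  have k: "1 \<le> k" "k < N" "k \<le> N" using Suc.hyps Suc.prems by simp_all
  have C: "C (Suc k)"
  proof (rule ccontr)
    assume "\<not> C (Suc k)"
    then show False using Suc.prems k by simp
  qed
  have pS: "p (Suc k) = (1, Suc k)"
    using p_col[of "Suc k"] C Suc.prems by (metis le_SucI prod.collapse Suc.hyps)
  have pk: "p k = (fst (p k), k)" using turn_snd[OF k(1,2) C] by (metis prod.collapse)
  have "(0, Suc k) \<notin> dom T'" using inc_shifted_pos[OF inc_T'] by force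
  \<comment> \<open>If the left box was hit, it holds \<open>X k\<close> by induction. Otherwise a
    lower box of column k was hit; it now holds at most \<open>X (Suc k)\<close>, and the left box
    holds less.\<close>
  moreover have "T' (1, k) \<noteq> Some (X (Suc k))"
  proof
    assume left: "T' (1, k) = Some (X (Suc k))"
    show False
    proof (cases "fst (p k) = 1")
      case True
      then have "T' (p k) = Some (X k)"
        using Suc.IH k C_Suc[OF k(1,2)] C by blast
      then show False using left True pk X_less_Suc[OF k(1,2)] by simp
    next
      case False
      obtain v where v: "T' (p k) = Some v" "v \<le> X (Suc k)"
        using T'_le[OF T_bump[OF k(1,2)]] by blast
      obtain a where a: "p k = (a, k)" using pk by blast
      then have "(a, k) \<in> dom T'" using v(1) by (metis domI)
      then have "1 < a" using inc_shifted_pos[OF inc_T', of a k] a False by simp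
      then show False
        using inc_shifted_mono(2)[OF inc_T' left, of a k v] v a by simp
    qed
  qed
  ultimately show ?case using trace[of "Suc k" 1 "Suc k"] Suc.prems pS by (simp add: domIff)
qed

text \<open>Column \<open>N\<close> consists of the boxes above \<open>p N\<close>, and there is at
  least one: in row 1 the value would have been written.\<close>

lemma bottom_stop:
  assumes "C N" "p N \<notin> dom T'"
  shows "2 \<le> fst (p N)" "bottom T' N = (fst (p N) - 1, N)" "(fst (p N) - 1, N) \<in> dom T'"
proof -
  obtain i where i: "p N = (i, N)" "1 \<le> i" "\<And>i'. (i', N) \<in> dom T \<longleftrightarrow> 1 \<le> i' \<and> i' < i"
    by (rule end_col[OF assms(1)]) (rule that; assumption)
  have "i \<noteq> 1" using row1_replaced[OF N1] assms i(1) by (auto simp: domIff)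
  then show two: "2 \<le> fst (p N)" using i by simp
  have dom: "dom T' = dom T" using dom_not_new assms(2) by simp
  show "(fst (p N) - 1, N) \<in> dom T'" unfolding dom i(3) using i(1) two by simp
  then show "bottom T' N = (fst (p N) - 1, N)"
    by (rule bottom_eq[OF inc_T']) (unfold dom i(3), use i(1) two in simp)
qed

lemma col_descends:
  assumes "1 \<le> k" "C (Suc k)" "Suc k \<le> N"
  shows "fst (p N) \<le> fst (p k)"
  using assms(3)
proof (induction N rule: dec_induct)
  case base
  then show ?case using next_col[of k] assms by simp
next
  case (step m)
  then have "C (Suc m)" using C_mono[of "Suc k" "Suc m"] assms by simp
  then show ?case using next_col[of m] assms step by simp
qed

text \<open>From \<open>p k\<close> on the path climbs weakly, and a failure at its end puts the
  label one row above \<open>p N\<close>. So equality of the rows certifies an added box, which is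
  how distinctness of termination boxes is obtained later.\<close>

lemma col_bound:
  assumes "1 \<le> k" "k < N" "C (Suc k)"
  shows "pr" "fst b \<le> fst (p k)" "fst b = fst (p k) \<Longrightarrow> p N \<in> dom T'"
proof -
  have C: "C N" using C_mono[of "Suc k" N] assms by simp
  have le: "fst (p N) \<le> fst (p k)" using col_descends assms by simp
  show pr using C new(3) not_new by (cases "p N \<in> dom T'") auto
  have fb: "fst b = fst (p N) - 1 \<and> 2 \<le> fst (p N)" if "p N \<notin> dom T'"
    using not_new[OF that] bottom_stop[OF C that] C by simp
  show "fst b \<le> fst (p k)" using le fb new(2) by (cases "p N \<in> dom T'") auto
  show "fst b = fst (p k) \<Longrightarrow> p N \<in> dom T'" using le fb by (cases "p N \<in> dom T'") auto
qed

lemma row_descends: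
  assumes "1 \<le> k" "k \<le> N" "\<not> C N"
  shows "snd (p N) \<le> snd (p k)"
proof -
  have row: "\<not> C m" if "1 \<le> m" "m \<le> N" for m using C_mono[OF that] assms(3) by blast
  have "m \<le> N \<Longrightarrow> snd (p m) \<le> snd (p k)" if "k \<le> m" for m
    using that
  proof (induction m rule: dec_induct)
    case (step m)
    then show ?case using next_row[of m] row[of "Suc m"] assms(1) by simp
  qed simp
  then show ?thesis using assms(2) by simp
qed

text \<open>Coordinates for an unprimed label without a new box: the label goes to the bottom of the
  column just left of \<open>p N\<close>.\<close>

lemma stop_row_nonempty:
  assumes "\<not> pr" "p N \<notin> dom T'"
  obtains e i where "\<not> C N" "p N = (N, Suc e)" "N \<le> e" "(N, e) \<in> dom T'" "(N, Suc e) \<notin> dom T'"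
    "b = (i, e)" "N \<le> i" "(i, e) \<in> dom T'" "(Suc i, e) \<notin> dom T'"
proof -
  have C: "\<not> C N" and ne: "row_entries T' N \<noteq> {}" and b: "b = bottom T' (snd (rightmost T' N))"
    using not_new[OF assms(2)] assms(1) by (auto split: if_splits)
  have dom: "dom T' = dom T" using dom_not_new assms(2) by simp
  obtain j where j: "p N = (N, j)" "N \<le> j" "\<And>j'. (N, j') \<in> dom T \<longleftrightarrow> N \<le> j' \<and> j' < j"
    by (rule end_row[OF C]) (rule that; assumption)
  obtain j0 where "(N, j0) \<in> dom T'" using ne unfolding row_entries_def by blast
  then have "N < j" unfolding dom j(3) by simp
  define e where "e = j - 1"
  have e: "j = Suc e" "N \<le> e" using \<open>N < j\<close> by (simp_all add: e_def)
  have Ne: "(N, e) \<in> dom T'" "(N, Suc e) \<notin> dom T'" unfolding dom j(3) e(1) using e by simp_all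
  then have b': "b = bottom T' e" using b rightmost_eq[OF inc_T'] by simp
  obtain i where i: "\<And>i'. (i', e) \<in> dom T' \<longleftrightarrow> 1 \<le> i' \<and> i' < i"
    using col_end_iff[OF inc_T', of e] by metis
  have Ni: "N < i" using Ne(1) unfolding i by simp
  have 1: "(i - 1, e) \<in> dom T'" "(Suc (i - 1), e) \<notin> dom T'" unfolding i using Ni N1 by simp_all
  then have "b = (i - 1, e)" using b' bottom_eq[OF inc_T'] by simp
  then show thesis using that C j(1) e Ne 1 Ni by simp
qed

lemma unprimed:
  assumes "\<not> pr"
  shows "\<not> C N" "N \<le> fst b"
proof -
  show C: "\<not> C N" using assms new(3) not_new by (cases "p N \<in> dom T'") (auto split: if_splits)
  show "N \<le> fst b"
  proof (cases "p N \<in> dom T'")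
    case True
    then show ?thesis using new(2) p_row[OF N1 le_refl C] by simp
  next
    case False
    then show ?thesis using stop_row_nonempty[OF assms False] by (metis fst_conv)
  qed
qed

text \<open>The box (N, N) has no left neighbour, so by \<open>trace\<close> its value is blocked
  from above by an equal entry; in particular the preceding row is nonempty.\<close>

lemma primed_row:
  assumes "pr" "\<not> C N"
  shows "p N \<notin> dom T'" "p N = (N, N)" "(N, N) \<notin> dom T'" "b = rightmost T' (N - 1)" "2 \<le> N" "fst b = N - 1"
    "T' (N - 1, N) = Some (X N)"
proof -
  show nn: "p N \<notin> dom T'" using new(3) assms by blast
  then have ne: "row_entries T' N = {}" and b: "b = rightmost T' (N - 1)"
    using not_new[OF nn] assms by (auto split: if_splits)
  have dom: "dom T' = dom T" using dom_not_new nn by simp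
  obtain j where j: "p N = (N, j)" "N \<le> j" "\<And>j'. (N, j') \<in> dom T \<longleftrightarrow> N \<le> j' \<and> j' < j"
    by (rule end_row[OF assms(2)]) (rule that; assumption)
  have NN: "(N, N) \<notin> dom T'" using ne unfolding row_entries_def by blast
  then have "j = N" unfolding dom j(3) using j(2) by simp
  then show pN: "p N = (N, N)" using j by simp
  show "(N, N) \<notin> dom T'" by (rule NN)
  have "(N, N - 1) \<notin> dom T'" using inc_shifted_pos[OF inc_T', of N "N - 1"] N1 by linarith
  then show above: "T' (N - 1, N) = Some (X N)"
    using trace[OF N1 le_refl pN] NN by (auto simp: domIff)
  then have "1 \<le> N - 1" using inc_shifted_pos[OF inc_T' domI] by blast
  then show "2 \<le> N" by simp
  show "b = rightmost T' (N - 1)" "fst b = N - 1" using b by simp_all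
qed

lemma primed_in:
  assumes "pr"
  shows "b \<in> dom T'"
proof (cases "p N \<in> dom T'")
  case True
  then show ?thesis using new(2) by simp
next
  case False
  show ?thesis
  proof (cases "C N")
    case C: True
    have "b = rightmost T' (fst (p N) - 1)"
      using not_new[OF False] C bottom_stop[OF C False] by simp
    then show ?thesis using rightmost_in[OF inc_T' bottom_stop(3)[OF C False]] by simp
  next
    case C: False
    have "(N - 1, N) \<in> dom T'" using primed_row(7)[OF assms C] by blast
    then show ?thesis using rightmost_in[OF inc_T'] primed_row(4)[OF assms C] by simp
  qed
qed

lemma line_bump:
  assumes "1 \<le> k" "k \<le> N" "on_line (C k) k s" "T s = Some v" "X k < v"
  shows "k < N \<and> X (Suc k) \<le> v"
  using T_stop[of s v] T_min[of k s v] assms by (cases "k = N") auto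

lemma line_bump_T':
  assumes "1 \<le> k" "k \<le> N" "on_line (C k) k s" "T' s = Some v" "X k < v"
  shows "k < N \<and> X (Suc k) \<le> v"
  using T'_above[OF assms(1,2,4,5)] line_bump[OF assms(1-3) _ assms(5)] by blast

text \<open>The diagonal entry is the smallest of its row, so once it exceeds the inserted value it
  is the one bumped.\<close>

lemma diag_bump:
  assumes k: "1 \<le> k" "k < N" and row: "\<not> C k" and v: "T (k, k) = Some v" "X k < v"
  shows "p k = (k, k)"
proof -
  obtain c where c: "p k = (k, c)" using p_row[of k] k row by (metis less_imp_le prod.collapse)
  have "X (Suc k) \<le> v" using T_min[OF k, of "(k, k)" v] v row by (simp add: on_line_def)
  moreover have Tc: "T (k, c) = Some (X (Suc k))" using T_bump[OF k] c by simp
  moreover have "k \<le> c" using inc_shifted_pos_Some[OF inc_T Tc] by simp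
  ultimately have "\<not> k < c" using inc_shifted_mono(2)[OF inc_T v(1) Tc] by force
  then show ?thesis using \<open>k \<le> c\<close> c by simp
qed

lemma column_primed: "C N \<Longrightarrow> pr"
  using new(3) not_new by (cases "p N \<in> dom T'") auto

text \<open>Together with \<open>column_box\<close> this identifies the termination row as the last
  row of column \<open>N\<close>, although the termination box itself may lie further right.\<close>

lemma column_last:
  assumes "C N" "(i, N) \<in> dom T'"
  shows "i \<le> fst b"
proof (cases "p N \<in> dom T'")
  case True
  show ?thesis
  proof (rule ccontr)
    assume less: "\<not> ?thesis"
    have pN: "snd (p N) = N" using p_col[OF N1 le_refl assms(1)] .
    note b = new(2)[OF True]
    have "(Suc (fst (p N)), N) \<in> dom T'"
      by (rule inc_shifted_down[OF inc_T' assms(2)])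
        (use less b inc_shifted_pos[OF inc_T' assms(2)] in simp_all)
    then show False using new_corner(2)[OF True] pN by simp
  qed
next
  case False
  obtain i' where i': "p N = (i', N)" "1 \<le> i'" "\<And>i''. (i'', N) \<in> dom T \<longleftrightarrow> 1 \<le> i'' \<and> i'' < i'"
    by (rule end_col[OF assms(1)]) (rule that; assumption)
  have "(i, N) \<in> dom T" using assms(2) dom_not_new[OF False] by simp
  then have "i < i'" using i'(3) by blast
  moreover have "fst b = i' - 1" using not_new[OF False] bottom_stop[OF assms(1) False] assms(1) i'(1) by simp
  ultimately show ?thesis by simp
qed

lemma column_box:
  assumes "C N"
  shows "(fst b, N) \<in> dom T'"
proof (cases "p N \<in> dom T'")
  case True
  then show ?thesis using new(2)[OF True] p_col[OF N1 le_refl assms] by (metis prod.collapse)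
next
  case False
  then show ?thesis using not_new[OF False] bottom_stop[OF assms False] assms by simp
qed

end

subsection \<open>Comparison of two successive insertions\<close>

text \<open>The clauses of \<open>tab_des\<close> for a single pair of successive labels, without
  quantifiers because each label sits in one box.\<close>

definition descent :: "nat \<times> nat \<Rightarrow> bool \<Rightarrow> nat \<times> nat \<Rightarrow> bool \<Rightarrow> bool" where
  "descent b pr b' pr' \<longleftrightarrow> \<not> pr \<and> pr' \<or> \<not> pr \<and> \<not> pr' \<and> fst b < fst b' \<or>
     pr \<and> pr' \<and> fst b' \<le> fst b \<and> b \<noteq> b'"

locale two_runs =
  a: hecke_run T T1 b1 pr1 N TT X C p + b: hecke_run T1 T2 b2 pr2 M UU Y D q
  for T T1 T2 :: tab and b1 b2 :: "nat \<times> nat" and pr1 pr2 :: bool and N M :: nat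
    and TT UU :: "nat \<Rightarrow> tab" and X Y :: "nat \<Rightarrow> nat" and C D :: "nat \<Rightarrow> bool"
    and p q :: "nat \<Rightarrow> nat \<times> nat"
begin

section \<open>The second inserted value is smaller\<close>

text \<open>By \<open>trace\<close>, \<open>T1\<close> has a copy of \<open>X i\<close> on line i,
  where it bounds \<open>Y (Suc i)\<close>, or on the preceding line. In the latter case
  \<open>q (i - 1)\<close>, holding \<open>Y i\<close> < \<open>X i\<close>, lies strictly before
  the copy; its neighbour on line i exceeds \<open>Y i\<close> and, if the first path goes on, stays
  below the unchanged entry \<open>X (Suc i)\<close> of \<open>p i\<close>.\<close>

lemma bump_same_line:
  assumes i: "1 \<le> i" "i \<le> N" "i \<le> M" and less: "Y i < X i" and same: "C i = D i"
  shows "i < M \<and> (i < N \<longrightarrow> Y (Suc i) < X (Suc i))"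
proof -
  obtain r c where pi: "p i = (r, c)" by (cases "p i")
  have X_line: ?thesis if "on_line (D i) i s" "T1 s = Some (X i)" for s
    using b.line_bump[OF i(1,3) that less] a.X_less_Suc[OF i(1)] by fastforce
  have ex: ?thesis if "on_line (D i) i s" "T1 s = Some v" "Y i < v" "i < N \<Longrightarrow> v < X (Suc i)" for s v
    using b.line_bump[OF i(1,3) that(1,2,3)] that(4) by fastforce
  show ?thesis
  proof (cases "C i")
    case row: False
    have rD: "\<not> D i" using row same by simp
    have r: "r = i" using a.p_row[OF i(1,2) row] pi by simp
    consider "T1 (i, c) = Some (X i)" | "T1 (i, c - 1) = Some (X i)"
      | "T1 (i, c) = T (i, c)" "T1 (i - 1, c) = Some (X i)"
      using a.trace[OF i(1,2) pi] r by blast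
    then show ?thesis
    proof cases
      case 3
      have k: "1 \<le> i - 1" "i - 1 < M" "Suc (i - 1) = i"
        using inc_shifted_pos_Some[OF b.inc_T 3(2)] i by simp_all
      have nD: "\<not> D (Suc (i - 1))" using rD k(3) by simp
      obtain c1 where qk: "q (i - 1) = (i - 1, c1)" and c1: "i \<le> c1"
        using b.row_snd[OF k(1,2) nD] k(3) by (metis prod.collapse)
      have Tq: "T1 (i - 1, c1) = Some (Y i)" using b.T_bump[OF k(1,2)] qk k(3) by simp
      have lt: "c1 < c"
        using inc_shifted_mono(1)[OF b.inc_T 3(2) Tq] less by (meson le_refl not_le)
      obtain u where u: "T (i, c1) = Some u" "u \<le> X i"
        by (rule a.before_row[OF i(1,2) row c1]) (use lt pi in auto)
      obtain v where v: "T1 (i, c1) = Some v" using a.T'_le[OF u(1)] by blast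
      have "Y i < v" using inc_shifted_mono(2)[OF b.inc_T Tq v] k(3) by fastforce
      moreover have "v < X (Suc i)" if "i < N"
      proof -
        have "T1 (i, c) = Some (X (Suc i))" using 3(1) a.T_bump[OF i(1) that] pi r by simp
        then show ?thesis using inc_shifted_mono(2)[OF b.inc_T v] lt by fastforce
      qed
      ultimately show ?thesis using ex[of "(i, c1)" v] v rD by (simp add: on_line_def)
    qed (use X_line rD in \<open>force simp: on_line_def\<close>)+
  next
    case col: True
    have cD: "D i" using col same by simp
    have c: "c = i" using a.p_col[OF i(1,2) col] pi by simp
    consider "T1 (r, i) = Some (X i)" | "T1 (r - 1, i) = Some (X i)"
      | "T1 (r, i) = T (r, i)" "T1 (r, i - 1) = Some (X i)"
      using a.trace[OF i(1,2) pi] c by blast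
    then show ?thesis
    proof cases
      case 3
      have k: "1 \<le> i - 1" "i - 1 < M" "Suc (i - 1) = i"
        using inc_shifted_pos_Some[OF b.inc_T 3(2)] i by simp_all
      have DS: "D (Suc (i - 1))" using cD k(3) by simp
      obtain r1 where qk: "q (i - 1) = (r1, i - 1)"
        using b.turn_snd[OF k(1,2) DS] by (metis prod.collapse)
      have Tq: "T1 (r1, i - 1) = Some (Y i)" using b.T_bump[OF k(1,2)] qk k(3) by simp
      have r1: "1 \<le> r1" using inc_shifted_pos_Some[OF b.inc_T Tq] by simp
      have lt: "r1 < r"
        using inc_shifted_mono(1)[OF b.inc_T 3(2) Tq] less by (meson le_refl not_le)
      obtain u where u: "T (r1, i) = Some u" "u \<le> X i"
        by (rule a.before_col[OF i(1,2) col r1]) (use lt pi in auto)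
      obtain v where v: "T1 (r1, i) = Some v" using a.T'_le[OF u(1)] by blast
      have "Y i < v" using inc_shifted_mono(2)[OF b.inc_T Tq v] k(3) by fastforce
      moreover have "v < X (Suc i)" if "i < N"
      proof -
        have "T1 (r, i) = Some (X (Suc i))" using 3(1) a.T_bump[OF i(1) that] pi c by simp
        then show ?thesis using inc_shifted_mono(2)[OF b.inc_T v] lt by fastforce
      qed
      ultimately show ?thesis using ex[of "(r1, i)" v] v cD by (simp add: on_line_def)
    qed (use X_line cD in \<open>force simp: on_line_def\<close>)+
  qed
qed

lemma runs_decreasing:
  assumes "Y 1 < X 1"
  shows "1 \<le> i \<Longrightarrow> i \<le> N \<Longrightarrow> i \<le> M \<and> Y i < X i \<and> (C i \<longrightarrow> D i)"
proof (induction i rule: nat_induct_at_least)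
  case base
  then show ?case using assms b.N1 a.start(2) by blast
next
  case (Suc i)
  have i: "1 \<le> i" "i < N" "i \<le> N" using Suc.hyps Suc.prems by simp_all
  then have IH: "i \<le> M" "Y i < X i" "C i \<longrightarrow> D i" using Suc.IH by simp_all
  show ?case
  proof (cases "C i = D i")
    case same: True
    then have step: "i < M" "Y (Suc i) < X (Suc i)" using bump_same_line[OF i(1,3) IH(1,2)] i by simp_all
    have "D (Suc i)" if "C (Suc i)"
    proof (cases "C i")
      case True
      then show ?thesis using b.C_Suc[OF i(1) step(1)] IH(3) by blast
    next
      case False
      then have pi: "p i = (i, i)" using a.C_Suc[OF i(1,2)] that by blast
      have Ti: "T (i, i) = Some (X (Suc i))" using a.T_bump[OF i(1,2)] pi by simp
      \<comment> \<open>The diagonal box holds \<open>X i\<close> or still \<open>X (Suc i)\<close>;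
        both exceed \<open>Y i\<close>, so the second path turns here too.\<close>
      obtain v where "T1 (i, i) = Some v" "Y i < v"
        using a.trace[OF i(1,3) pi] Ti IH(2) a.X_less_Suc[OF i(1,2)] by auto
      then have "q i = (i, i)" using b.diag_bump[OF i(1) step(1)] False same by simp
      then show ?thesis using b.C_Suc[OF i(1) step(1)] by blast
    qed
    then show ?thesis using step by simp
  next
    case False
    \<comment> \<open>Mixed modes: the second path is already in column i. The entry of (r, i), to
      the right of its previous box, exceeds \<open>Y i\<close> and is smaller than the diagonal
      entry, which is at most the entry of \<open>T1\<close> in the box hit by the first
      path.\<close>
    then have CD: "\<not> C i" "D i" using IH(3) by auto
    then have "i \<noteq> 1" using b.start(2) by blast
    then have k: "1 \<le> i - 1" "i - 1 < M" "Suc (i - 1) = i" using i IH(1) by simp_all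
    have DS: "D (Suc (i - 1))" using CD k(3) by simp
    obtain r where qk: "q (i - 1) = (r, i - 1)"
      using b.turn_snd[OF k(1,2) DS] by (metis prod.collapse)
    have Tq: "T1 (r, i - 1) = Some (Y i)" using b.T_bump[OF k(1,2)] qk k(3) by simp
    have r: "1 \<le> r" "r \<le> i - 1" using inc_shifted_pos_Some[OF b.inc_T Tq] by simp_all
    obtain c where pi: "p i = (i, c)" using a.p_row[OF i(1,3) CD(1)] by (metis prod.collapse)
    have Tp: "T (i, c) = Some (X (Suc i))" using a.T_bump[OF i(1,2)] pi by simp
    then obtain x where x: "T1 (i, c) = Some x" "x \<le> X (Suc i)" by (rule a.T'_le)
    have ic: "i \<le> c" using inc_shifted_pos_Some[OF b.inc_T x(1)] by simp
    have in_T1: "(i, i) \<in> dom T1" by (rule inc_shifted_down_Some[OF b.inc_T x(1)]) (use i ic in simp_all)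
    then obtain u where u: "T1 (i, i) = Some u" by blast
    have "(r, i) \<in> dom T1" by (rule inc_shifted_down[OF b.inc_T in_T1]) (use r in linarith)+
    then obtain v where v: "T1 (r, i) = Some v" by blast
    have "Y i < v" using inc_shifted_mono(2)[OF b.inc_T Tq v] k by fastforce
    then have "i < M" "Y (Suc i) \<le> v"
      using b.line_bump[OF i(1) IH(1), of "(r, i)" v] v CD by (simp_all add: on_line_def)
    moreover have "v < u" using inc_shifted_mono(2)[OF b.inc_T v u] r k by fastforce
    moreover have "u \<le> x" using inc_shifted_mono(1)[OF b.inc_T u x(1)] ic by simp
    ultimately show ?thesis using x(2) b.C_Suc[OF i(1)] CD by simp
  qed
qed

lemma decreasing_descent:
  assumes "Y 1 < X 1"
  shows "descent b1 pr1 b2 pr2"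
proof -
  note N1 = a.N1
  have DN: "N \<le> M" "Y N < X N" "C N \<longrightarrow> D N" using runs_decreasing[OF assms N1 le_refl] by simp_all
  \<comment> \<open>A primed first label sits in a box of \<open>T1\<close>, a box added by the
    second insertion does not.\<close>
  have b2_notin: "b1 \<noteq> b2" if "pr1" "q M \<in> dom T2"
    using a.primed_in[OF that(1)] b.new(2)[OF that(2)] b.p_N_notin by metis
  consider "\<not> C N" "D N" | "\<not> C N" "\<not> D N" | "C N" "D N" using DN(3) by blast
  then show ?thesis
  proof cases
    case 1
    then have "N \<noteq> 1" using b.start(2) by blast
    then have k: "1 \<le> N - 1" "N - 1 < M" "Suc (N - 1) = N" using N1 DN(1) by simp_all
    have DS: "D (Suc (N - 1))" using 1 k(3) by simp
    note bound = b.col_bound[OF k(1,2) DS]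
    have "snd (q (N - 1)) = N - 1" using b.turn_snd[OF k(1,2) DS] .
    then have fq: "fst (q (N - 1)) \<le> N - 1"
      \<comment> \<open>Boxes lie on or above the diagonal, so column N - 1 bounds the row; a primed
        first label in this case lies exactly in row N - 1.\<close>
      by (metis inc_shifted_pos[OF b.inc_T] b.p_in[OF k(1,2)] prod.collapse)
    show ?thesis
    proof (cases pr1)
      case True
      have f1: "fst b1 = N - 1" using a.primed_row(6)[OF True 1(1)] .
      have "b1 \<noteq> b2"
      proof
        assume "b1 = b2"
        then have "q M \<in> dom T2" using bound fq f1 by simp
        then show False using b2_notin True \<open>b1 = b2\<close> by blast
      qed
      then show ?thesis using True bound(1,2) fq f1 by (simp add: descent_def)
    qed (use bound in \<open>simp add: descent_def\<close>)
  next
    case 2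
    then have NM: "N < M" using bump_same_line[OF N1 le_refl DN(1,2)] by simp
    obtain j1 where qN: "q N = (N, j1)" using b.p_row[of N] N1 NM 2 by (metis less_imp_le prod.collapse)
    have in_T1: "(N, j1) \<in> dom T1" using b.p_in[OF N1 NM] qN by simp
    have "\<not> pr1"
    proof
      assume pr1
      have "(N, N) \<in> dom T1"
        by (rule inc_shifted_down[OF b.inc_T in_T1]) (use inc_shifted_pos[OF b.inc_T in_T1] in simp_all)
      then show False using a.primed_row(3)[OF \<open>pr1\<close> 2(1)] by blast
    qed
    moreover have "fst b1 < fst b2" if "\<not> pr2"
    proof (cases "p N \<in> dom T1")
      case True
      then show ?thesis using a.new(2)[OF True] a.p_row[OF N1 le_refl 2(1)] b.unprimed(2)[OF that] NM by simp
    next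
      case False
      obtain e i where e: "(N, Suc e) \<notin> dom T1" "b1 = (i, e)" "(i, e) \<in> dom T1"
        by (rule a.stop_row_nonempty[OF \<open>\<not> pr1\<close> False]) (rule that; assumption)
      \<comment> \<open>Otherwise column \<open>e\<close> reaches down to row \<open>M\<close>, and
        the second path, moving weakly left from row \<open>N\<close>, would end inside
        \<open>T1\<close>.\<close>
      have "i < M"
      proof (rule ccontr)
        assume "\<not> i < M"
        have rM: "\<not> D M" using b.unprimed(1)[OF that] .
        have "snd (q M) \<le> j1" using b.row_descends[of N] N1 NM rM qN by simp
        moreover have "j1 \<le> e"
        proof (rule ccontr)
          assume "\<not> j1 \<le> e"
          have "i \<le> e" using inc_shifted_pos[OF b.inc_T e(3)] by simp
          then have "(N, Suc e) \<in> dom T1"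
            by (intro inc_shifted_down[OF b.inc_T in_T1])
              (use N1 NM \<open>\<not> j1 \<le> e\<close> \<open>\<not> i < M\<close> in simp_all)
          then show False using e(1) by blast
        qed
        moreover have qM: "q M = (M, snd (q M))" using b.p_row[OF b.N1 le_refl rM] by (metis prod.collapse)
        moreover have "M \<le> snd (q M)" using b.addable[OF b.N1 le_refl qM] by simp
        ultimately have "(M, snd (q M)) \<in> dom T1"
          by (intro inc_shifted_down[OF b.inc_T e(3)]) (use b.N1 \<open>\<not> i < M\<close> in simp_all)
        then show False using b.p_N_notin qM by simp
      qed
      then show ?thesis using e(2) b.unprimed(2)[OF that] by simp
    qed
    ultimately show ?thesis by (auto simp: descent_def)
  next
    case 3
    then have NM: "N < M" using bump_same_line[OF N1 le_refl DN(1,2)] by simp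
    have DS: "D (Suc N)" using b.C_Suc[OF N1 NM] 3 by blast
    note bound = b.col_bound[OF N1 NM DS]
    \<comment> \<open>The second path still bumps an entry of column \<open>N\<close>, and the first
      label lies in the last row of that column.\<close>
    have "q N = (fst (q N), N)" using b.turn_snd[OF N1 NM DS] by (metis prod.collapse)
    then have "(fst (q N), N) \<in> dom T1" using b.p_in[OF N1 NM] by simp
    then have le: "fst (q N) \<le> fst b1" using a.column_last[OF 3(1)] by blast
    have pr1: pr1 using a.column_primed[OF 3(1)] .
    have "b1 \<noteq> b2"
    proof
      assume "b1 = b2"
      then have "q M \<in> dom T2" using bound le by simp
      then show False using b2_notin pr1 \<open>b1 = b2\<close> by blast
    qed
    then show ?thesis using pr1 bound(1,2) le by (simp add: descent_def)
  qed
qed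

section \<open>The second inserted value is at least as large\<close>

lemma runs_increasing:
  assumes "X 1 \<le> Y 1"
  shows "1 \<le> i \<Longrightarrow> i \<le> M \<Longrightarrow> i \<le> N \<and> X i \<le> Y i \<and> (D i \<longrightarrow> C i)"
proof (induction i rule: nat_induct_at_least)
  case base
  then show ?case using assms a.N1 b.start(2) by blast
next
  case (Suc i)
  have i: "1 \<le> i" "i < M" "i \<le> M" using Suc.hyps Suc.prems by simp_all
  then have IH: "i \<le> N" "X i \<le> Y i" "D i \<longrightarrow> C i" using Suc.IH by simp_all
  have Tq: "T1 (q i) = Some (Y (Suc i))" using b.T_bump[OF i(1,2)] .
  have lt: "X i < Y (Suc i)" using b.X_less_Suc[OF i(1,2)] IH(2) by simp
  show ?case
  proof (cases "C i = D i")
    case same: True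
    then have step: "i < N" "X (Suc i) \<le> Y (Suc i)"
      using a.line_bump_T'[OF i(1) IH(1) _ Tq lt] b.bump_line[OF i(1,2)] by simp_all
    have "C (Suc i)" if "D (Suc i)"
    proof (cases "D i")
      case True
      then show ?thesis using a.C_Suc[OF i(1) step(1)] IH(3) by blast
    next
      case False
      then have qi: "q i = (i, i)" using b.C_Suc[OF i(1,2)] that by blast
      have row: "\<not> C i" using False same by simp
      obtain c where c: "p i = (i, c)" using a.p_row[OF i(1) IH(1) row] by (metis prod.collapse)
      then have in_T: "(i, c) \<in> dom T" using a.p_in[OF i(1) step(1)] by simp
      have "(i, i) \<in> dom T"
        by (rule inc_shifted_down[OF a.inc_T in_T]) (use inc_shifted_pos[OF a.inc_T in_T] in simp_all)
      then obtain u where u: "T (i, i) = Some u" by blast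
      then obtain v where "T1 (i, i) = Some v" "v \<le> u" by (rule a.T'_le)
      then have "X i < u" using Tq qi lt by simp
      then have "p i = (i, i)" using a.diag_bump[OF i(1) step(1) row u] by blast
      then show ?thesis using a.C_Suc[OF i(1) step(1)] by blast
    qed
    then show ?thesis using step by simp
  next
    case False
    then have CD: "C i" "\<not> D i" using IH(3) by auto
    then have "i \<noteq> 1" using a.start(2) by blast
    then have k: "1 \<le> i - 1" "i - 1 < N" "Suc (i - 1) = i" using i IH(1) by simp_all
    have CS: "C (Suc (i - 1))" using CD k(3) by simp
    obtain r where pk: "p (i - 1) = (r, i - 1)"
      using a.turn_snd[OF k(1,2) CS] by (metis prod.collapse)
    have Tp: "T (r, i - 1) = Some (X i)" using a.T_bump[OF k(1,2)] pk k(3) by simp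
    have r: "1 \<le> r" "r \<le> i - 1" using inc_shifted_pos_Some[OF a.inc_T Tp] by simp_all
    obtain r' where pi: "p i = (r', i)" using a.p_col[OF i(1) IH(1) CD(1)] by (metis prod.collapse)
    have r': "r' < i" using a.next_col[OF k(1,2) CS] k r pi pk by simp
    \<comment> \<open>The first path meets column i above the diagonal, so it leaves the entry of
      (i, i) alone; this common entry of \<open>T\<close> and \<open>T1\<close> separates
      \<open>X (Suc i)\<close> from \<open>Y (Suc i)\<close>.\<close>
    have not_pi: "(i, i) \<noteq> p l" if "1 \<le> l" "l \<le> N" for l
    proof
      assume l: "(i, i) = p l"
      then have "l = i" using a.p_col[OF that] a.p_row[OF that] by (metis fst_conv snd_conv)
      then show False using l pi r' by simp
    qed
    obtain c where qi: "q i = (i, c)" using b.p_row[OF i(1,3) CD(2)] by (metis prod.collapse)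
    have Tc: "T1 (i, c) = Some (Y (Suc i))" using Tq qi by simp
    have ic: "i \<le> c" using inc_shifted_pos_Some[OF b.inc_T Tc] by simp
    have in_T1: "(i, i) \<in> dom T1"
      by (rule inc_shifted_down_Some[OF b.inc_T Tc]) (use i ic in simp_all)
    then obtain u where u1: "T1 (i, i) = Some u" by blast
    have u: "T (i, i) = Some u"
      by (rule a.T'_cases[of "(i, i)"]) (use not_pi u1 in auto)
    have "(r, i) \<in> dom T"
      by (rule inc_shifted_down_Some[OF a.inc_T u]) (use r in linarith)+
    then obtain v where v: "T (r, i) = Some v" by blast
    have "X i < v" using inc_shifted_mono(2)[OF a.inc_T Tp v] k by fastforce
    then have iN: "i < N"
      using a.line_bump[OF i(1) IH(1), of "(r, i)" v] v CD by (simp add: on_line_def)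
    have "T (r', i) = Some (X (Suc i))" using a.T_bump[OF i(1) iN] pi by simp
    then have "X (Suc i) < u" using inc_shifted_mono(2)[OF a.inc_T _ u] r' by fastforce
    moreover have "u \<le> Y (Suc i)" using inc_shifted_mono(1)[OF b.inc_T u1 Tc] ic by simp
    ultimately show ?thesis using iN a.C_Suc[OF i(1) iN] CD by simp
  qed
qed

lemma increasing_no_descent:
  assumes "X 1 \<le> Y 1"
  shows "\<not> descent b1 pr1 b2 pr2"
proof -
  note M1 = b.N1
  have AM: "M \<le> N" "X M \<le> Y M" "D M \<longrightarrow> C M" using runs_increasing[OF assms M1 le_refl] by simp_all
  \<comment> \<open>If the first path is in row mode on line \<open>M\<close>, so is the second, and
    a primed end would need an empty row \<open>M\<close>.\<close>
  have unprimed2: "\<not> pr2" if "(M, j) \<in> dom T1" "\<not> C M" for j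
  proof
    assume pr2
    have "(M, M) \<in> dom T1"
      by (rule inc_shifted_down[OF b.inc_T that(1)]) (use inc_shifted_pos[OF b.inc_T that(1)] in simp_all)
    then have "(M, M) \<in> dom T2" by (rule b.dom_mono)
    then show False using b.primed_row(3)[OF \<open>pr2\<close>] that(2) AM(3) by blast
  qed
  show ?thesis
  proof (cases "C M")
    case row: False
    then have rD: "\<not> D M" using AM(3) by blast
    show ?thesis
    proof (cases "pr1 \<and> M = N")
      case True
      then have pr1: pr1 and MN: "M = N" and CN: "\<not> C N" using row by auto
      show ?thesis
      proof (cases pr2)
        case pr2: True
        \<comment> \<open>Both insertions fail in the same empty row, so their termination boxes
          coincide.\<close>
        have "dom T2 = dom T1" using b.dom_not_new b.primed_row(1)[OF pr2 rD] by blast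
        then have "b2 = b1"
          using a.primed_row(4)[OF pr1 CN] b.primed_row(4)[OF pr2 rD] MN rightmost_dom by metis
        then show ?thesis using pr1 by (simp add: descent_def)
      qed (use pr1 in \<open>simp add: descent_def\<close>)
    next
      case other: False
      have ex: "\<exists>j. (M, j) \<in> dom T1"
      proof (cases "M = N")
        case MN: True
        then have npr1: "\<not> pr1" using other by simp
        show ?thesis
        proof (cases "p N \<in> dom T1")
          case True
          then show ?thesis using a.p_row[of N] a.N1 MN row by (metis le_refl prod.collapse)
        next
          case False
          then show ?thesis using a.stop_row_nonempty[OF npr1 False] MN by metis
        qed
      next
        case False
        then have MN: "M < N" using AM(1) by simp
        have "p M = (M, snd (p M))" using a.p_row[OF M1 AM(1) row] by (metis prod.collapse)
        then show ?thesis using a.dom_mono[OF a.p_in[OF M1 MN]] by metis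
      qed
      then have npr2: "\<not> pr2" using unprimed2 row by blast
      have "fst b2 \<le> fst b1" if npr1: "\<not> pr1"
      proof (cases "q M \<in> dom T2")
        case True
        then have "fst b2 = M" using b.new(2)[OF True] b.p_row[OF M1 le_refl rD] by simp
        then show ?thesis using a.unprimed(2)[OF npr1] AM(1) by simp
      next
        case False
        have dom: "dom T2 = dom T1" using b.dom_not_new[OF False] .
        obtain e i where e: "(M, e) \<in> dom T1" "(M, Suc e) \<notin> dom T1" "b2 = (i, e)" "M \<le> i"
          "(i, e) \<in> dom T1" "(Suc i, e) \<notin> dom T1"
          using b.stop_row_nonempty[OF npr2 False] unfolding dom by metis
        have ie: "i \<le> e" using inc_shifted_pos[OF b.inc_T e(5)] by simp
        have CN: "\<not> C N" and Nb: "N \<le> fst b1" using a.unprimed[OF npr1] by auto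
        have le_e: "j \<le> e" if "(M, j) \<in> dom T1" for j
        proof (rule ccontr)
          assume "\<not> j \<le> e"
          have "(M, Suc e) \<in> dom T1"
            by (rule inc_shifted_down[OF b.inc_T that]) (use M1 e(4) ie \<open>\<not> j \<le> e\<close> in simp_all)
          then show False using e(2) by blast
        qed
        show ?thesis
        proof (cases "p N \<in> dom T1")
          case new: True
          have pN: "p N = (N, snd (p N))" using a.p_row[OF a.N1 le_refl CN] by (metis prod.collapse)
          have in_T1: "(N, snd (p N)) \<in> dom T1" using new pN by simp
          \<comment> \<open>If column \<open>e\<close> reached below row \<open>N\<close>, the box
            added by the first insertion, weakly left of that column, would have a box to its right
            or below.\<close>
          have "i \<le> N"
          proof (rule ccontr)
            assume iN: "\<not> i \<le> N"
            have "snd (p N) \<le> snd (p M)" using a.row_descends[OF M1 AM(1) CN] .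
            moreover have "snd (p M) \<le> e"
            proof (cases "M = N")
              case False
              then have MN: "M < N" using AM(1) by simp
              have "p M = (M, snd (p M))" using a.p_row[OF M1 AM(1) row] by (metis prod.collapse)
              then show ?thesis using a.dom_mono[OF a.p_in[OF M1 MN]] le_e by metis
            qed (use in_T1 le_e in simp)
            ultimately have le: "snd (p N) \<le> e" by simp
            have "\<not> snd (p N) < e"
            proof
              assume "snd (p N) < e"
              have "(N, Suc (snd (p N))) \<in> dom T1"
                by (rule inc_shifted_down[OF b.inc_T e(5)])
                  (use a.N1 iN \<open>snd (p N) < e\<close> inc_shifted_pos[OF b.inc_T in_T1] in simp_all)
              then show False using a.new_corner(1)[OF new] pN by (metis fst_conv)
            qed
            then have eq: "snd (p N) = e" using le by simp
            have "(Suc N, e) \<in> dom T1"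
              by (rule inc_shifted_down[OF b.inc_T e(5)]) (use iN ie in simp_all)
            then show False using a.new_corner(2)[OF new] pN eq by (metis fst_conv)
          qed
          then show ?thesis using e(3) Nb by simp
        next
          case stop: False
          obtain e' i' where e': "p N = (N, Suc e')" "(N, e') \<in> dom T1" "(N, Suc e') \<notin> dom T1"
            "b1 = (i', e')" "(i', e') \<in> dom T1" "(Suc i', e') \<notin> dom T1"
            using a.stop_row_nonempty[OF npr1 stop] by metis
          show ?thesis
          proof (cases "M = N")
            case True
            then have "e' = e" using same_row_end[OF b.inc_T] e(1,2) e'(2,3) by blast
            then have "(i', e') = (i, e)"
              using bottom_eq[OF b.inc_T e(5,6)] bottom_eq[OF b.inc_T e'(5,6)] by simp
            then show ?thesis using e(3) e'(4) by simp
          next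
            case False
            then have MN: "M < N" using AM(1) by simp
            have "p M = (M, snd (p M))" using a.p_row[OF M1 AM(1) row] by (metis prod.collapse)
            then have "snd (p M) \<le> e" using a.dom_mono[OF a.p_in[OF M1 MN]] le_e by metis
            then have le: "Suc e' \<le> e" using a.row_descends[OF M1 AM(1) CN] e'(1) by simp
            \<comment> \<open>Otherwise closure from the bottom box of column \<open>e\<close> would
              put the box behind the end of row \<open>N\<close> into the shape.\<close>
            have "i \<le> N"
            proof (rule ccontr)
              assume iN: "\<not> i \<le> N"
              have "(N, Suc e') \<in> dom T1"
                by (rule inc_shifted_down[OF b.inc_T e(5)])
                  (use a.N1 iN le inc_shifted_pos[OF b.inc_T e'(2)] in simp_all)
              then show False using e'(3) by blast
            qed
            then show ?thesis using e(3) Nb by simp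
          qed
        qed
      qed
      then show ?thesis using npr2 by (auto simp: descent_def)
    qed
  next
    case col: True
    have CN: "C N" using a.C_mono[OF M1 AM(1) le_refl col] .
    have pr1: pr1 using a.column_primed[OF CN] .
    show ?thesis
    proof (cases pr2)
      case pr2: True
      \<comment> \<open>An added box must lie strictly lower. Without one the shapes agree, and
        equal rows give equal boxes by \<open>primed_rightmost\<close>.\<close>
      have main: ?thesis if "fst b1 \<le> fst b2" "q M \<in> dom T2 \<Longrightarrow> fst b1 < fst b2"
      proof (cases "q M \<in> dom T2")
        case True
        then show ?thesis using that pr1 by (simp add: descent_def)
      next
        case False
        have "rightmost T2 = rightmost T1" using rightmost_dom b.dom_not_new[OF False] by blast
        then have "b1 = b2" if "fst b1 = fst b2"
          using that a.primed_rightmost[OF pr1] b.primed_rightmost[OF pr2] by metis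
        then show ?thesis using that(1) pr1 by (auto simp: descent_def)
      qed
      show ?thesis
      proof (cases "D M")
        case row: False
        have M2: "1 \<le> M - 1" "M - 1 < N" "Suc (M - 1) = M" using b.primed_row(5)[OF pr2 row] AM(1) by simp_all
        have CS: "C (Suc (M - 1))" using col M2(3) by simp
        have "snd (p (M - 1)) = M - 1" using a.turn_snd[OF M2(1,2) CS] .
        then have "fst (p (M - 1)) \<le> M - 1"
          by (metis inc_shifted_pos[OF a.inc_T] a.p_in[OF M2(1,2)] prod.collapse)
        then have "fst b1 \<le> fst b2"
          using a.col_bound(2)[OF M2(1,2) CS] b.primed_row(6)[OF pr2 row] by simp
        then show ?thesis using main b.primed_row(1)[OF pr2 row] by blast
      next
        case colD: True
        \<comment> \<open>The witness is the termination row if the first path stops on line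
          \<open>M\<close>, and otherwise the row of the box it hits there, from which it only
          climbs.\<close>
        obtain i where i: "(i, M) \<in> dom T1" "fst b1 \<le> i"
        proof (cases "M = N")
          case True
          then show ?thesis using that a.column_box[OF CN] by blast
        next
          case False
          then have MN: "M < N" using AM(1) by simp
          have CS: "C (Suc M)" using a.C_Suc[OF M1 MN] col by blast
          have "p M = (fst (p M), M)" using a.turn_snd[OF M1 MN CS] by (metis prod.collapse)
          then have "(fst (p M), M) \<in> dom T1" using a.dom_mono[OF a.p_in[OF M1 MN]] by simp
          then show ?thesis using that a.col_bound(2)[OF M1 MN CS] by blast
        qed
        have in_T2: "(i, M) \<in> dom T2" using b.dom_mono[OF i(1)] .
        have "fst b1 \<le> fst b2" using i b.column_last[OF colD in_T2] by simp
        moreover have "fst b1 < fst b2" if "q M \<in> dom T2"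
        proof -
          have "b2 = q M" using b.new(2)[OF that] .
          moreover have "i \<noteq> fst (q M)"
            using i(1) b.p_N_notin b.p_col[OF M1 le_refl colD] by (metis prod.collapse)
          ultimately show ?thesis using b.column_last[OF colD in_T2] i(2) by simp
        qed
        ultimately show ?thesis by (rule main)
      qed
    qed (use pr1 in \<open>simp add: descent_def\<close>)
  qed
qed

end

lemma hecke_insert_descent:
  assumes "inc_shifted T" "hecke_insert T x = (T1, b1, pr1)" "hecke_insert T1 y = (T2, b2, pr2)"
  shows "descent b1 pr1 b2 pr2 \<longleftrightarrow> y < x" "inc_shifted T1"
proof -
  obtain N TT X C p where a: "hecke_run T T1 b1 pr1 N TT X C p" "X 1 = x"
    using hecke_insert_run[OF assms(1,2)] .
  then show "inc_shifted T1" by (simp add: hecke_run.inc_T')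
  then obtain M UU Y D q where b: "hecke_run T1 T2 b2 pr2 M UU Y D q" "Y 1 = y"
    using hecke_insert_run[OF _ assms(3)] by blast
  interpret two_runs T T1 T2 b1 b2 pr1 pr2 N M TT UU X Y C D p q
    by (rule two_runs.intro[OF a(1) b(1)])
  show "descent b1 pr1 b2 pr2 \<longleftrightarrow> y < x"
    using decreasing_descent increasing_no_descent a(2) b(2) by (cases "y < x") auto
qed

subsection \<open>Recording tableaux\<close>

lemma hecke_PQ_snoc:
  "hecke_PQ (w @ [x]) = hecke_step (hecke_PQ w) (Suc (length w), x)"
proof -
  have upt: "[1..<length (w @ [x]) + 1] = [1..<length w + 1] @ [Suc (length w)]" by simp
  show ?thesis unfolding hecke_PQ_def upt by (simp del: upt_Suc)
qed

lemma inc_shifted_empty: "inc_shifted Map.empty"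
  by (simp add: inc_shifted_def shifted_shape_iff increasing_def)

lemma hecke_P_snoc:
  "fst (hecke_PQ (w @ [x])) = fst (hecke_insert (fst (hecke_PQ w)) x)"
  by (simp add: hecke_PQ_snoc hecke_step_def split: prod.splits)

lemma inc_shifted_hecke_P: "inc_shifted (fst (hecke_PQ w))"
proof (induction w rule: rev_induct)
  case Nil
  then show ?case by (simp add: hecke_PQ_def inc_shifted_empty)
next
  case (snoc x w)
  then show ?case
    using hecke_insert_descent(2)[of "fst (hecke_PQ w)" x] hecke_P_snoc[of w x]
    by (metis prod.collapse)
qed

text \<open>Label \<open>k\<close> is written only by the \<open>k\<close>-th insertion, so its box
  and prime are determined by the first \<open>k\<close> letters.\<close>

lemma hecke_Q_label_iff:
  "(k, c) \<in> hecke_Q w b \<longleftrightarrow> 1 \<le> k \<and> k \<le> length w \<and>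
     snd (hecke_insert (fst (hecke_PQ (take (k - 1) w))) (w ! (k - 1))) = (b, c)"
proof (induction w rule: rev_induct)
  case Nil
  then show ?case by (simp add: hecke_Q_def hecke_PQ_def)
next
  case (snoc x w)
  obtain P' b' c' where ins: "hecke_insert (fst (hecke_PQ w)) x = (P', b', c')"
    by (metis prod.exhaust)
  have "(k, c) \<in> hecke_Q (w @ [x]) b \<longleftrightarrow>
      (k, c) \<in> hecke_Q w b \<or> k = Suc (length w) \<and> (b', c') = (b, c)"
    using ins by (auto simp: hecke_Q_def hecke_PQ_snoc hecke_step_def split: prod.splits)
  then show ?case
    using snoc.IH ins by (cases "k = Suc (length w)") (auto simp: nth_append)
qed

theorem theorem3:
  fixes w :: "nat list"
  assumes "\<forall>x\<in>set w. 0 < x"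
  shows "word_des w = tab_des (hecke_Q w) (length w)"
proof -
  have "i \<in> word_des w \<longleftrightarrow> i \<in> tab_des (hecke_Q w) (length w)" if i: "1 \<le> i" "i < length w" for i
  proof -
    obtain P b c where 1: "hecke_insert (fst (hecke_PQ (take (i - 1) w))) (w ! (i - 1)) = (P, b, c)"
      by (metis prod.exhaust)
    have "take i w = take (i - 1) w @ [w ! (i - 1)]"
      using take_Suc_conv_app_nth[of "i - 1" w] i by simp
    then have P: "fst (hecke_PQ (take i w)) = P" using hecke_P_snoc 1 by simp
    obtain P' b' c' where 2: "hecke_insert P (w ! i) = (P', b', c')"
      by (metis prod.exhaust)
    have label: "(i, pr) \<in> hecke_Q w a \<longleftrightarrow> a = b \<and> pr = c"
      "(Suc i, pr) \<in> hecke_Q w a \<longleftrightarrow> a = b' \<and> pr = c'" for pr a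
      using i 1 2 P by (auto simp: hecke_Q_label_iff)
    have "i \<in> tab_des (hecke_Q w) (length w) \<longleftrightarrow> descent b c b' c'"
      using i by (cases b; cases b'; simp add: tab_des_def descent_def label)
    also have "\<dots> \<longleftrightarrow> w ! i < w ! (i - 1)"
      using hecke_insert_descent(1)[OF inc_shifted_hecke_P 1 2] .
    finally show ?thesis using i by (simp add: word_des_def)
  qed
  moreover have "1 \<le> i \<and> i < length w" if "i \<in> word_des w" for i
    using that by (simp add: word_des_def)
  moreover have "1 \<le> i \<and> i < length w" if "i \<in> tab_des (hecke_Q w) (length w)" for i
    using that unfolding tab_des_def by blast
  ultimately show ?thesis by blast
qed

end
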